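(* Let $(G,\tau,\partial)$ be a Polish topometric group with ample generics, let $H$ be a topological group with uniform Souslin number $<2^{\aleph_0}$, and let $\varphi\colon G\to H$ be a group homomorphism that is continuous from $(G,\partial)$ into $H$. Then $\varphi$ is continuous from $(G,\tau)$ into $H$.
   Context: A topometric space is a triple $(X,\tau,\partial)$ where $\tau$ is a topology on $X$ and $\partial$ is a metric on $X$ whose topology refines $\tau$ and which is $\tau$-lower semi-continuous, i.e. $\{(x,y)\colon \partial(x,y)\le r\}$ is closed in $(X,\tau)^2$ for every $r$. A Polish topometric group is a triple $(G,\tau,\partial)$ which is a topometric space such that $(G,\tau)$ is a Polish group and $\partial$ is bi-invariant ($\partial$ need not be separable). For $A\subseteq Y$ in a metric space $(Y,\partial)$ and $\varepsilon>0$, $(A)_\varepsilon=\{y\colon \partial(y,A)<\varepsilon\}$. For each $n$, $G^n$ carries the product topology and the supremum metric $\partial(\bar g,\bar h)=\max_i\partial(g_i,h_i)$, and $G$ acts on $G^n$ by diagonal conjugation $k\cdot(g_0,\dots,g_{n-1})=(kg_0k^{-1},\dots,kg_{n-1}k^{-1})$. The Polish topometric group $(G,\tau,\partial)$ has ample generics if for every $n\in\mathbb N$ and every $\varepsilon>0$ there is $\bar g\in G^n$ such that $(\{k\cdot\bar g\colon k\in G\})_\varepsilon$ is co-meagre in $(G^n,\tau)$. A topological group $H$ has uniform Souslin number $\kappa$ if $\kappa$ is the least cardinal such that for every neighbourhood $V$ of $1_H$, $H$ can be covered by fewer than $\kappa$ left translates of $V$. *)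

theory Defs
  imports "HOL-Analysis.Analysis" "HOL-Algebra.Group" "HOL-Algebra.Coset"
begin

unbundle cardinal_syntax

definition nowhere_dense_in :: "'a topology \<Rightarrow> 'a set \<Rightarrow> bool" where
  "nowhere_dense_in X S \<longleftrightarrow> S \<subseteq> topspace X \<and> X interior_of (X closure_of S) = {}"

definition meagre_in :: "'a topology \<Rightarrow> 'a set \<Rightarrow> bool" where
  "meagre_in X S \<longleftrightarrow> (\<exists>\<G>. countable \<G> \<and> (\<forall>N\<in>\<G>. nowhere_dense_in X N) \<and> S \<subseteq> \<Union>\<G>)"

definition comeagre_in :: "'a topology \<Rightarrow> 'a set \<Rightarrow> bool" where
  "comeagre_in X S \<longleftrightarrow> S \<subseteq> topspace X \<and> meagre_in X (topspace X - S)"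

definition Polish_space :: "'a topology \<Rightarrow> bool" where
  "Polish_space X \<longleftrightarrow> completely_metrizable_space X \<and> separable_space X"

definition topological_group :: "('a, 'b) monoid_scheme \<Rightarrow> 'a topology \<Rightarrow> bool" where
  "topological_group G T \<longleftrightarrow> group G \<and> topspace T = carrier G \<and>
     continuous_map (prod_topology T T) T (\<lambda>(x, y). x \<otimes>\<^bsub>G\<^esub> y) \<and>
     continuous_map T T (\<lambda>x. inv\<^bsub>G\<^esub> x)"

definition Polish_group :: "('a, 'b) monoid_scheme \<Rightarrow> 'a topology \<Rightarrow> bool" where
  "Polish_group G T \<longleftrightarrow> topological_group G T \<and> Polish_space T"

definition topometric_space :: "'a topology \<Rightarrow> ('a \<Rightarrow> 'a \<Rightarrow> real) \<Rightarrow> bool" where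
  "topometric_space T d \<longleftrightarrow> Metric_space (topspace T) d \<and>
     (\<forall>U. openin T U \<longrightarrow> openin (Metric_space.mtopology (topspace T) d) U) \<and>
     (\<forall>r::real. closedin (prod_topology T T)
        {(x, y). x \<in> topspace T \<and> y \<in> topspace T \<and> d x y \<le> r})"

definition bi_invariant :: "('a, 'b) monoid_scheme \<Rightarrow> ('a \<Rightarrow> 'a \<Rightarrow> real) \<Rightarrow> bool" where
  "bi_invariant G d \<longleftrightarrow> (\<forall>k\<in>carrier G. \<forall>x\<in>carrier G. \<forall>y\<in>carrier G.
     d (k \<otimes>\<^bsub>G\<^esub> x) (k \<otimes>\<^bsub>G\<^esub> y) = d x y \<and> d (x \<otimes>\<^bsub>G\<^esub> k) (y \<otimes>\<^bsub>G\<^esub> k) = d x y)"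

definition Polish_topometric_group ::
    "('a, 'b) monoid_scheme \<Rightarrow> 'a topology \<Rightarrow> ('a \<Rightarrow> 'a \<Rightarrow> real) \<Rightarrow> bool" where
  "Polish_topometric_group G T d \<longleftrightarrow>
     Polish_group G T \<and> topometric_space T d \<and> bi_invariant G d"

text \<open>G^n is represented as the extensional functions {..<n} \<rightarrow> carrier G,
  with the product topology and the supremum metric.\<close>
definition power_topology :: "'a topology \<Rightarrow> nat \<Rightarrow> (nat \<Rightarrow> 'a) topology" where
  "power_topology T n = product_topology (\<lambda>i. T) {..<n}"

definition sup_dist :: "('a \<Rightarrow> 'a \<Rightarrow> real) \<Rightarrow> nat \<Rightarrow> (nat \<Rightarrow> 'a) \<Rightarrow> (nat \<Rightarrow> 'a) \<Rightarrow> real" where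
  "sup_dist d n g h = Max (insert 0 ((\<lambda>i. d (g i) (h i)) ` {..<n}))"

definition diag_conj :: "('a, 'b) monoid_scheme \<Rightarrow> nat \<Rightarrow> 'a \<Rightarrow> (nat \<Rightarrow> 'a) \<Rightarrow> (nat \<Rightarrow> 'a)" where
  "diag_conj G n k g = (\<lambda>i. if i < n then k \<otimes>\<^bsub>G\<^esub> g i \<otimes>\<^bsub>G\<^esub> inv\<^bsub>G\<^esub> k else undefined)"

definition eps_nbhd :: "'p set \<Rightarrow> ('p \<Rightarrow> 'p \<Rightarrow> real) \<Rightarrow> 'p set \<Rightarrow> real \<Rightarrow> 'p set" where
  "eps_nbhd Y dd A \<epsilon> = {y \<in> Y. (INF a\<in>A. dd y a) < \<epsilon>}"

definition ample_generics ::
    "('a, 'b) monoid_scheme \<Rightarrow> 'a topology \<Rightarrow> ('a \<Rightarrow> 'a \<Rightarrow> real) \<Rightarrow> bool" where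
  "ample_generics G T d \<longleftrightarrow> (\<forall>n::nat. \<forall>\<epsilon>>0. \<exists>g \<in> topspace (power_topology T n).
     comeagre_in (power_topology T n)
       (eps_nbhd (topspace (power_topology T n)) (sup_dist d n)
          ((\<lambda>k. diag_conj G n k g) ` carrier G) \<epsilon>))"

definition nbhd_of :: "'a topology \<Rightarrow> 'a \<Rightarrow> 'a set \<Rightarrow> bool" where
  "nbhd_of X x V \<longleftrightarrow> V \<subseteq> topspace X \<and> (\<exists>U. openin X U \<and> x \<in> U \<and> U \<subseteq> V)"

definition covered_by_fewer_translates ::
    "('a, 'b) monoid_scheme \<Rightarrow> 'a topology \<Rightarrow> 'k rel \<Rightarrow> bool" where
  "covered_by_fewer_translates H TH \<kappa> \<longleftrightarrow>
     (\<forall>V. nbhd_of TH \<one>\<^bsub>H\<^esub> V \<longrightarrow>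
        (\<exists>S. S \<subseteq> carrier H \<and> |S| <o \<kappa> \<and> carrier H \<subseteq> (\<Union>s\<in>S. s <#\<^bsub>H\<^esub> V)))"

text \<open>The uniform Souslin number (the least such kappa) is < 2^aleph_0.  Since the
  covering property is upward closed in kappa, this holds iff some cardinal kappa < continuum
  has the property; every cardinal < continuum is the cardinality of a set of reals.\<close>
definition uniform_souslin_lt_continuum :: "('a, 'b) monoid_scheme \<Rightarrow> 'a topology \<Rightarrow> bool" where
  "uniform_souslin_lt_continuum H TH \<longleftrightarrow>
     (\<exists>K::real set. |K| <o |UNIV::real set| \<and> covered_by_fewer_translates H TH |K| )"

end

(* Let V be a small symmetric neighbourhood of 1 in H and A = phi^-1(V). Fewer than continuum many
   translates of V cover H, so of any continuum many elements of G indexed by 2^N, two have their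
   quotient in phi^-1(V^-1 V).
   Applied to a Mycielski-type perfect set this shows that A is non-meagre.
   If the complement B of a power of A were non-meagre in every open set, ample generics would give
   a Cantor scheme h : 2^N -> G such that, for distinct a and b, some conjugate of an element of A
   by h(a) is d-close to a conjugate of an element of B by h(b). Choosing a, b with
   h(b)^-1 h(a) in A contradicts d-continuity of phi. Hence a power of A is comeagre in some
   nonempty open set, and Pettis' argument gives a neighbourhood of 1.
   The Cantor scheme rests on an approximate Effros theorem for the diagonal conjugation action. *)
theory Submission
  imports Defs
begin

section \<open>Baire category\<close>

text \<open>Two metrics share the work. A compatible complete metric \<open>m\<close> makes infinite
  products of group elements converge, but it need not be invariant, so the size of a factor is
  measured at the product already built. Under the bi-invariant \<open>d\<close> errors simply add
  along conjugations, and lower semicontinuity carries the resulting bounds to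
  \<open>m\<close>-limits. Families indexed by 2^N are forced: a cover by fewer than continuum many
  translates need not produce a collision in a countable family. The colliding pair is not known in
  advance, so a coincidence is prepared for every pair, at the first place where the two indices
  differ. Since A is not known to have the Baire property, being non-meagre does not make it
  comeagre in an open set; the dichotomy on the complement of a larger set takes the place of that
  step. A and B play different roles: an element of A is picked first and B must then supply one in
  a neighbourhood dictated by it. Hence B has to be non-meagre in every open set, while for A it is
  enough not to be meagre.\<close>

lemma meagre_in_subset: "meagre_in X S \<Longrightarrow> R \<subseteq> S \<Longrightarrow> meagre_in X R"
  unfolding meagre_in_def by (meson order_trans)

lemma nowhere_dense_imp_meagre: "nowhere_dense_in X S \<Longrightarrow> meagre_in X S"
  unfolding meagre_in_def by (intro exI[of _ "{S}"]) auto

lemma closed_empty_interior_imp_meagre: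
  "closedin X S \<Longrightarrow> X interior_of S = {} \<Longrightarrow> meagre_in X S"
  by (intro nowhere_dense_imp_meagre)
    (simp add: nowhere_dense_in_def closedin_subset closure_of_closedin)

lemma meagre_in_UN:
  assumes "countable I" "\<And>i. i \<in> I \<Longrightarrow> meagre_in X (S i)"
  shows "meagre_in X (\<Union>i\<in>I. S i)"
proof -
  obtain F where F: "\<And>i. i \<in> I \<Longrightarrow>
      countable (F i) \<and> (\<forall>N\<in>F i. nowhere_dense_in X N) \<and> S i \<subseteq> \<Union>(F i)"
    using assms(2) unfolding meagre_in_def by metis
  show ?thesis
    unfolding meagre_in_def
  proof (intro exI[of _ "\<Union>i\<in>I. F i"] conjI ballI)
    show "countable (\<Union>i\<in>I. F i)" using F assms(1) by (intro countable_UN) auto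
    show "nowhere_dense_in X N" if "N \<in> (\<Union>i\<in>I. F i)" for N using F that by auto
    show "(\<Union>i\<in>I. S i) \<subseteq> \<Union>(\<Union>i\<in>I. F i)" using F by fastforce
  qed
qed

lemma meagre_in_Un:
  assumes "meagre_in X S" "meagre_in X R"
  shows "meagre_in X (S \<union> R)"
proof -
  have "meagre_in X (\<Union>b\<in>UNIV. if b then S else R)"
    by (rule meagre_in_UN) (use assms in auto)
  then show ?thesis by (simp add: UNIV_bool Un_commute)
qed

lemma meagre_in_closed_cover:
  assumes "meagre_in X S"
  shows "\<exists>F :: nat \<Rightarrow> 'a set.
    (\<forall>n. closedin X (F n)) \<and> (\<forall>n. X interior_of (F n) = {}) \<and> S \<subseteq> (\<Union>n. F n)"
proof -
  obtain \<G> where \<G>: "countable \<G>" "\<And>N. N \<in> \<G> \<Longrightarrow> nowhere_dense_in X N" "S \<subseteq> \<Union>\<G>"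
    using assms unfolding meagre_in_def by blast
  \<comment> \<open>The added empty set makes the family nonempty, so that
    \<open>from_nat_into\<close> enumerates exactly its members.\<close>
  define \<G>' where "\<G>' = insert {} \<G>"
  have c: "countable \<G>'" "\<G>' \<noteq> {}" using \<G>(1) by (auto simp: \<G>'_def)
  have nd: "nowhere_dense_in X N" if "N \<in> \<G>'" for N
    using that \<G>(2) by (auto simp: \<G>'_def nowhere_dense_in_def)
  have r: "range (from_nat_into \<G>') = \<G>'"
    using c by (simp add: range_from_nat_into)
  define F where "F n = X closure_of (from_nat_into \<G>' n)" for n
  have nF: "nowhere_dense_in X (from_nat_into \<G>' n)" for n
    using nd r by blast
  have "S \<subseteq> (\<Union>n. F n)"
  proof
    fix x assume "x \<in> S"
    then obtain N where "N \<in> \<G>'" "x \<in> N" using \<G>(3) by (auto simp: \<G>'_def)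
    then obtain n where "N = from_nat_into \<G>' n" using r by blast
    then show "x \<in> (\<Union>n. F n)"
      using \<open>x \<in> N\<close> closure_of_subset[of "from_nat_into \<G>' n" X] nF[of n]
      by (auto simp: F_def nowhere_dense_in_def)
  qed
  then show ?thesis
    using nF by (intro exI[of _ F]) (auto simp: F_def nowhere_dense_in_def)
qed

lemma Baire_not_meagre:
  assumes "completely_metrizable_space X" "openin X U" "U \<noteq> {}"
  shows "\<not> meagre_in X U"
proof
  assume "meagre_in X U"
  then obtain F :: "nat \<Rightarrow> 'a set" where F: "\<And>n. closedin X (F n)"
    "\<And>n. X interior_of (F n) = {}" "U \<subseteq> (\<Union>n. F n)"
    using meagre_in_closed_cover by metis
  have "X interior_of \<Union>(range F) = {}"
    by (rule Baire_category_alt) (use assms F in auto)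
  then show False
    using interior_of_maximal[OF F(3) assms(2)] assms(3) by auto
qed

text \<open>An open set inside the preimage of a closed set has an open image inside that closed
  set, so empty interiors pull back. Serves for translations, inversion and the homeomorphism
  between finite powers.\<close>

lemma meagre_in_open_map_vimage:
  assumes "continuous_map X Y f" "open_map X Y f" "meagre_in Y S"
  shows "meagre_in X {x \<in> topspace X. f x \<in> S}"
proof -
  obtain F :: "nat \<Rightarrow> 'b set" where F: "\<And>n. closedin Y (F n)"
    "\<And>n. Y interior_of (F n) = {}" "S \<subseteq> (\<Union>n. F n)"
    using meagre_in_closed_cover[OF assms(3)] by metis
  have "meagre_in X {x \<in> topspace X. f x \<in> F n}" for n
  proof (rule closed_empty_interior_imp_meagre)
    show "closedin X {x \<in> topspace X. f x \<in> F n}"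
      by (rule closedin_continuous_map_preimage[OF assms(1) F(1)])
    let ?I = "X interior_of {x \<in> topspace X. f x \<in> F n}"
    have "openin Y (f ` ?I)"
      using assms(2) openin_interior_of unfolding open_map_def by blast
    moreover have "f ` ?I \<subseteq> F n"
      using interior_of_subset[of X "{x \<in> topspace X. f x \<in> F n}"] by blast
    ultimately show "?I = {}"
      using F(2)[of n] interior_of_maximal[of "f ` ?I" "F n" Y] by simp
  qed
  then have "meagre_in X (\<Union>n. {x \<in> topspace X. f x \<in> F n})"
    by (intro meagre_in_UN) auto
  then show ?thesis
    by (rule meagre_in_subset) (use F(3) in auto)
qed

section \<open>Category in products: the Kuratowski-Ulam theorem\<close>

lemma second_countableE:
  assumes "second_countable X"
  obtains \<B> where "countable \<B>" "\<And>V. V \<in> \<B> \<Longrightarrow> openin X V"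
    "\<And>U y. openin X U \<Longrightarrow> y \<in> U \<Longrightarrow> \<exists>V\<in>\<B>. y \<in> V \<and> V \<subseteq> U"
proof -
  obtain \<B> where \<B>: "countable \<B> \<and> (\<forall>V \<in> \<B>. openin X V) \<and>
      (\<forall>U x. openin X U \<and> x \<in> U \<longrightarrow> (\<exists>V \<in> \<B>. x \<in> V \<and> V \<subseteq> U))"
    using assms unfolding second_countable_def by (elim exE)
  show thesis by (rule that[of \<B>]) (use \<B> in simp_all)
qed

text \<open>For a closed set with empty interior, the section at an exceptional \<open>x\<close>
  contains a nonempty basic open \<open>V\<close>. For fixed \<open>V\<close> such \<open>x\<close>
  form a closed set, because its complement is the projection of an open set; and its interior is
  empty, because interior times \<open>V\<close> would be an open box inside the given set. The
  basis being countable, only countably many such sets arise.\<close>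

theorem Kuratowski_Ulam:
  fixes X :: "'a topology" and Y :: "'b topology"
  assumes "second_countable Y" "meagre_in (prod_topology X Y) M"
  shows "meagre_in X {x \<in> topspace X. \<not> meagre_in Y {y. (x, y) \<in> M}}"
proof -
  obtain F :: "nat \<Rightarrow> ('a \<times> 'b) set" where F: "\<And>n. closedin (prod_topology X Y) (F n)"
    "\<And>n. prod_topology X Y interior_of (F n) = {}" "M \<subseteq> (\<Union>n. F n)"
    using meagre_in_closed_cover[OF assms(2)] by metis
  obtain \<B> where \<B>: "countable \<B>" "\<And>V. V \<in> \<B> \<Longrightarrow> openin Y V"
    "\<And>U y. openin Y U \<Longrightarrow> y \<in> U \<Longrightarrow> \<exists>V\<in>\<B>. y \<in> V \<and> V \<subseteq> U"
    using second_countableE[OF assms(1)] by metis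
  define N where "N n V = {x \<in> topspace X. \<forall>y\<in>V. (x, y) \<in> F n}" for n V
  have "meagre_in X (N n V)" if V: "V \<in> \<B>" "V \<noteq> {}" for n V
  proof (rule closed_empty_interior_imp_meagre)
    have oV: "openin Y V" using \<B>(2) V by blast
    have "openin (prod_topology X Y) (topspace X \<times> V - F n)"
      using oV F(1) by (intro openin_diff) (auto simp: openin_prod_Times_iff)
    then have "openin X (fst ` (topspace X \<times> V - F n))"
      using open_map_fst by (auto simp: open_map_def)
    moreover have "fst ` (topspace X \<times> V - F n) = topspace X - N n V"
      by (force simp: N_def)
    ultimately show "closedin X (N n V)"
      by (auto simp: closedin_def N_def)
    let ?I = "X interior_of N n V"
    have "openin (prod_topology X Y) (?I \<times> V)"
      using oV by (auto simp: openin_prod_Times_iff)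
    moreover have "?I \<times> V \<subseteq> F n"
      using interior_of_subset[of X "N n V"] by (auto simp: N_def)
    ultimately show "?I = {}"
      using interior_of_maximal[of "?I \<times> V" "F n" "prod_topology X Y"] F(2)[of n] V(2) by auto
  qed
  \<comment> \<open>The empty set is left out because \<open>N n {}\<close> is the whole
    space.\<close>
  then have *: "meagre_in X (\<Union>(n, V)\<in>UNIV \<times> (\<B> - {{}}). N n V)"
    using \<B>(1) by (intro meagre_in_UN) auto
  show ?thesis
  proof (rule meagre_in_subset[OF *], intro subsetI, rule ccontr)
    fix x assume "x \<in> {x \<in> topspace X. \<not> meagre_in Y {y. (x, y) \<in> M}}"
      and xN: "x \<notin> (\<Union>(n, V)\<in>UNIV \<times> (\<B> - {{}}). N n V)"
    then have x: "x \<in> topspace X" "\<not> meagre_in Y {y. (x, y) \<in> M}" by simp_all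
    have "meagre_in Y {y \<in> topspace Y. (x, y) \<in> F n}" for n
    proof (rule closed_empty_interior_imp_meagre)
      have "continuous_map Y (prod_topology X Y) (\<lambda>y. (x, y))"
        using x(1) by (simp add: continuous_map_pairedI)
      then show "closedin Y {y \<in> topspace Y. (x, y) \<in> F n}"
        by (rule closedin_continuous_map_preimage[OF _ F(1)])
      show "Y interior_of {y \<in> topspace Y. (x, y) \<in> F n} = {}"
      proof (rule ccontr)
        assume "Y interior_of {y \<in> topspace Y. (x, y) \<in> F n} \<noteq> {}"
        then obtain y where "y \<in> Y interior_of {y \<in> topspace Y. (x, y) \<in> F n}" by blast
        then obtain V where V: "V \<in> \<B>" "y \<in> V" "V \<subseteq> Y interior_of {y \<in> topspace Y. (x, y) \<in> F n}"
          using \<B>(3)[OF openin_interior_of] by meson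
        then have "x \<in> N n V"
          using x(1) interior_of_subset[of Y "{y \<in> topspace Y. (x, y) \<in> F n}"]
          by (auto simp: N_def)
        then show False using xN V by auto
      qed
    qed
    then have "meagre_in Y (\<Union>n. {y \<in> topspace Y. (x, y) \<in> F n})"
      by (intro meagre_in_UN) auto
    moreover have "{y. (x, y) \<in> M} \<subseteq> (\<Union>n. {y \<in> topspace Y. (x, y) \<in> F n})"
    proof
      fix y assume "y \<in> {y. (x, y) \<in> M}"
      then obtain n where "(x, y) \<in> F n" using F(3) by blast
      moreover then have "y \<in> topspace Y" using closedin_subset[OF F(1)[of n]] by auto
      ultimately show "y \<in> (\<Union>n. {y \<in> topspace Y. (x, y) \<in> F n})" by blast
    qed
    ultimately show False using x(2) meagre_in_subset by blast
  qed
qed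

text \<open>In a Baire space, for \<open>S\<close> with the Baire property, this says that
  \<open>S\<close> is comeagre in \<open>U\<close>. For arbitrary \<open>S\<close> it is the usable
  substitute: \<open>S\<close> meets every open part of \<open>U\<close> outside any given meagre
  set.\<close>

definition everywhere_nonmeagre :: "'a topology \<Rightarrow> 'a set \<Rightarrow> 'a set \<Rightarrow> bool" where
  "everywhere_nonmeagre X S U \<longleftrightarrow>
    (\<forall>W. openin X W \<and> W \<noteq> {} \<and> W \<subseteq> U \<longrightarrow> \<not> meagre_in X (S \<inter> W))"

lemma meagre_in_frontier_of_open:
  assumes "openin X U"
  shows "meagre_in X (X frontier_of U)"
proof (rule closed_empty_interior_imp_meagre)
  show "X interior_of (X frontier_of U) = {}"
  proof (rule ccontr)
    let ?I = "X interior_of (X frontier_of U)"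
    assume ne: "?I \<noteq> {}"
    have "?I \<subseteq> X frontier_of U" by (rule interior_of_subset)
    then have 1: "?I \<inter> X frontier_of U \<noteq> {}" and 2: "?I \<inter> U = {}"
      using ne frontier_of_openin[OF assms] by auto
    show False
      using frontier_of_openin_straddle_Int(1)[OF openin_interior_of 1] 2 by simp
  qed
qed (rule closedin_frontier_of)

text \<open>The Banach category theorem. Let O be the union of the basic open sets in which
  \<open>S\<close> is meagre. By countability \<open>S\<close> is meagre in O, and the frontier of O
  is meagre. Off the closure of O no nonempty open set meets \<open>S\<close> in a meagre set, since
  it would contain a basic one that belongs to O.\<close>

lemma meagre_in_not_locally_nonmeagre:
  assumes "second_countable X" "S \<subseteq> topspace X"
  shows "meagre_in X {z \<in> S. \<not> (\<exists>U. openin X U \<and> z \<in> U \<and> everywhere_nonmeagre X S U)}"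
proof -
  obtain \<B> where \<B>: "countable \<B>" "\<And>V. V \<in> \<B> \<Longrightarrow> openin X V"
    "\<And>U y. openin X U \<Longrightarrow> y \<in> U \<Longrightarrow> \<exists>V\<in>\<B>. y \<in> V \<and> V \<subseteq> U"
    using second_countableE[OF assms(1)] by metis
  define \<C> where "\<C> = {V \<in> \<B>. meagre_in X (S \<inter> V)}"
  have o: "openin X (\<Union>\<C>)" using \<B>(2) by (auto simp: \<C>_def)
  have "meagre_in X (\<Union>V\<in>\<C>. S \<inter> V)"
    using \<B>(1) by (intro meagre_in_UN) (auto simp: \<C>_def)
  then have *: "meagre_in X ((\<Union>V\<in>\<C>. S \<inter> V) \<union> X frontier_of (\<Union>\<C>))"
    by (intro meagre_in_Un meagre_in_frontier_of_open o)
  show ?thesis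
  proof (rule meagre_in_subset[OF *], intro subsetI, rule UnCI)
    fix z assume "z \<in> {z \<in> S. \<not> (\<exists>U. openin X U \<and> z \<in> U \<and> everywhere_nonmeagre X S U)}"
      "z \<notin> X frontier_of \<Union>\<C>"
    then have z: "z \<in> S" "\<not> (\<exists>U. openin X U \<and> z \<in> U \<and> everywhere_nonmeagre X S U)"
      "z \<notin> X frontier_of \<Union>\<C>" by simp_all
    let ?U = "topspace X - X closure_of (\<Union>\<C>)"
    have "everywhere_nonmeagre X S ?U"
      unfolding everywhere_nonmeagre_def
    proof (intro allI impI notI)
      fix W assume W: "openin X W \<and> W \<noteq> {} \<and> W \<subseteq> ?U" "meagre_in X (S \<inter> W)"
      then obtain V y where V: "V \<in> \<B>" "y \<in> V" "V \<subseteq> W" using \<B>(3) by blast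
      then have "V \<in> \<C>"
        unfolding \<C>_def using W(2) meagre_in_subset[of X "S \<inter> W" "S \<inter> V"] by blast
      then show False
        using V W closure_of_subset[OF openin_subset[OF o]] by blast
    qed
    moreover have "openin X ?U" by (intro openin_diff openin_topspace closedin_closure_of)
    ultimately have "z \<in> X closure_of (\<Union>\<C>)" using z assms(2) by blast
    then have "z \<in> \<Union>\<C>" using z(3) o by (simp add: frontier_of_def interior_of_openin)
    then show "z \<in> (\<Union>V\<in>\<C>. S \<inter> V)" using z(1) by blast
  qed
qed

lemma everywhere_nonmeagre_meets:
  assumes "everywhere_nonmeagre X S U" "openin X W" "W \<noteq> {}" "W \<subseteq> U"
    "meagre_in X M"
  obtains x where "x \<in> S" "x \<in> W" "x \<notin> M"
  using assms meagre_in_subset[of X M "S \<inter> W"] unfolding everywhere_nonmeagre_def by blast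

section \<open>Finite powers of a space\<close>

lemma topspace_power_topology:
  "topspace (power_topology T n) = (\<Pi>\<^sub>E i\<in>{..<n}. topspace T)"
  by (simp add: power_topology_def)

lemma fun_upd_in_topspace_power:
  "x \<in> topspace (power_topology T n) \<Longrightarrow> y \<in> topspace T \<Longrightarrow>
    x(n := y) \<in> topspace (power_topology T (Suc n))"
  by (auto simp: topspace_power_topology PiE_def extensional_def Pi_def less_Suc_eq)

text \<open>Splitting off the last coordinate makes Kuratowski-Ulam available on finite powers and
  makes the extension of a fixed tuple by one entry continuous.\<close>

lemma homeomorphic_maps_power_Suc:
  "homeomorphic_maps (prod_topology (power_topology T n) T) (power_topology T (Suc n))
     (\<lambda>(x, y). x(n := y)) (\<lambda>z. (restrict z {..<n}, z n))"
proof -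
  have "continuous_map (prod_topology (power_topology T n) T) T (\<lambda>z. ((fst z)(n := snd z)) i)"
    if "i < Suc n" for i
  proof (cases "i = n")
    case False
    then have i: "i < n" using that by simp
    have "continuous_map (power_topology T n) T (\<lambda>x. x i)"
      unfolding power_topology_def using i by (intro continuous_map_product_projection) auto
    then have "continuous_map (prod_topology (power_topology T n) T) T (\<lambda>z. fst z i)"
      using continuous_map_compose[OF continuous_map_fst] by (auto simp: o_def)
    then show ?thesis using False by simp
  qed (simp add: continuous_map_snd)
  moreover have "((fst z)(n := snd z)) \<in> extensional {..<Suc n}"
    if "z \<in> topspace (prod_topology (power_topology T n) T)" for z
    using that by (auto simp: topspace_power_topology PiE_def extensional_def)
  ultimately have 1: "continuous_map (prod_topology (power_topology T n) T)
      (power_topology T (Suc n)) (\<lambda>z. (fst z)(n := snd z))"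
    by (subst (2) power_topology_def) (auto simp: continuous_map_componentwise)
  have "continuous_map (power_topology T (Suc n)) (power_topology T n) (\<lambda>z. restrict z {..<n})"
    unfolding power_topology_def
    by (subst continuous_map_componentwise) (auto intro: continuous_map_product_projection)
  moreover have "continuous_map (power_topology T (Suc n)) T (\<lambda>z. z n)"
    unfolding power_topology_def by (auto intro: continuous_map_product_projection)
  ultimately have 2: "continuous_map (power_topology T (Suc n))
      (prod_topology (power_topology T n) T) (\<lambda>z. (restrict z {..<n}, z n))"
    by (simp add: continuous_map_pairedI)
  have r: "restrict (x(n := y)) {..<n} = x" if "x \<in> topspace (power_topology T n)" for x and y :: 'a
    using that by (auto simp: topspace_power_topology PiE_def extensional_def fun_eq_iff)
  have s: "(restrict z {..<n})(n := z n) = z" if "z \<in> topspace (power_topology T (Suc n))" for z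
    using that by (auto simp: topspace_power_topology PiE_def extensional_def fun_eq_iff)
  show ?thesis
    unfolding homeomorphic_maps_def using 1 2 r s by (auto simp: case_prod_unfold)
qed

lemma second_countable_prod_topology:
  assumes "second_countable X" "second_countable Y"
  shows "second_countable (prod_topology X Y)"
proof -
  obtain \<B> where \<B>: "countable \<B>" "\<And>V. V \<in> \<B> \<Longrightarrow> openin X V"
    "\<And>U y. openin X U \<Longrightarrow> y \<in> U \<Longrightarrow> \<exists>V\<in>\<B>. y \<in> V \<and> V \<subseteq> U"
    using second_countableE[OF assms(1)] by metis
  obtain \<C> where \<C>: "countable \<C>" "\<And>V. V \<in> \<C> \<Longrightarrow> openin Y V"
    "\<And>U y. openin Y U \<Longrightarrow> y \<in> U \<Longrightarrow> \<exists>V\<in>\<C>. y \<in> V \<and> V \<subseteq> U"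
    using second_countableE[OF assms(2)] by metis
  show ?thesis
    unfolding second_countable_def
  proof (intro exI[of _ "(\<lambda>(U, V). U \<times> V) ` (\<B> \<times> \<C>)"] conjI allI impI)
    fix U z assume U: "openin (prod_topology X Y) U \<and> z \<in> U"
    obtain x y where z: "z = (x, y)" by force
    obtain A B where "openin X A" "openin Y B" "x \<in> A" "y \<in> B" "A \<times> B \<subseteq> U"
      using U unfolding z openin_prod_topology_alt by blast
    moreover obtain A' where "A' \<in> \<B>" "x \<in> A'" "A' \<subseteq> A"
      using \<B>(3) calculation by blast
    moreover obtain B' where "B' \<in> \<C>" "y \<in> B'" "B' \<subseteq> B"
      using \<C>(3) calculation by blast
    ultimately show "\<exists>V\<in>(\<lambda>(U, V). U \<times> V) ` (\<B> \<times> \<C>). z \<in> V \<and> V \<subseteq> U"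
      using z \<open>A \<times> B \<subseteq> U\<close> by (intro bexI[of _ "A' \<times> B'"]) auto
  qed (use \<B> \<C> in \<open>auto simp: openin_prod_Times_iff\<close>)
qed

lemma second_countable_power_topology:
  assumes "second_countable T"
  shows "second_countable (power_topology T n)"
proof (induction n)
  case 0
  have fin: "finite (topspace (power_topology T 0))" by (simp add: topspace_power_topology)
  show ?case
    unfolding second_countable_def
  proof (intro exI[of _ "{U. openin (power_topology T 0) U}"] conjI)
    show "countable {U. openin (power_topology T 0) U}"
      by (rule countable_finite, rule finite_subset[of _ "Pow (topspace (power_topology T 0))"])
        (use fin openin_subset in auto)
  qed auto
next
  case (Suc n)
  have "prod_topology (power_topology T n) T homeomorphic_space power_topology T (Suc n)"
    using homeomorphic_maps_power_Suc homeomorphic_maps_imp_homeomorphic_space by blast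
  then show ?case
    using Suc assms second_countable_prod_topology homeomorphic_space_second_countability by blast
qed

lemma completely_metrizable_power_topology:
  assumes "completely_metrizable_space T"
  shows "completely_metrizable_space (power_topology T n)"
  unfolding power_topology_def
  using assms by (simp add: completely_metrizable_space_product_topology countable_finite)

lemma meagre_in_power_Suc_sections:
  assumes "second_countable T" "meagre_in (power_topology T (Suc n)) M"
  shows "meagre_in (power_topology T n)
    {x \<in> topspace (power_topology T n). \<not> meagre_in T {y \<in> topspace T. x(n := y) \<in> M}}"
proof -
  let ?P = "prod_topology (power_topology T n) T"
  let ?M = "{z \<in> topspace ?P. (\<lambda>(x, y). x(n := y)) z \<in> M}"
  have "homeomorphic_map ?P (power_topology T (Suc n)) (\<lambda>(x, y). x(n := y))"
    using homeomorphic_maps_power_Suc homeomorphic_maps_imp_map by blast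
  then have "meagre_in ?P ?M"
    using meagre_in_open_map_vimage[OF _ _ assms(2)] homeomorphic_imp_continuous_map
      homeomorphic_imp_open_map by blast
  moreover have "{y. (x, y) \<in> ?M} = {y \<in> topspace T. x(n := y) \<in> M}"
    if "x \<in> topspace (power_topology T n)" for x
    using that by auto
  ultimately show ?thesis
    using Kuratowski_Ulam[OF assms(1), of "power_topology T n" ?M]
    by (simp cong: conj_cong)
qed

section \<open>Completely metrized groups\<close>

lemma (in Metric_space) geometric_sequence_converges:
  assumes "mcomplete" and s: "\<And>n. s n \<in> M"
    and step: "\<And>n. d (s n) (s (Suc n)) \<le> e n" and e: "\<And>n. e (Suc n) \<le> e n / 2"
  shows "\<exists>l\<in>M. limitin mtopology s l sequentially \<and> (\<forall>n. d (s n) l \<le> 2 * e n)"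
proof -
  have e0: "0 \<le> e n" for n using step[of n] nonneg order_trans by blast
  \<comment> \<open>Telescoping: since \<open>e\<close> at least halves, a step of size
    \<open>e k\<close> is covered by \<open>2 * e k - 2 * e (Suc k)\<close>.\<close>
  have bd: "d (s n) (s (n + k)) \<le> 2 * e n - 2 * e (n + k)" for n k
  proof (induction k)
    case 0 show ?case using s by simp
  next
    case (Suc k)
    have "d (s n) (s (n + Suc k)) \<le> d (s n) (s (n + k)) + d (s (n + k)) (s (n + Suc k))"
      using s triangle by simp
    then show ?case using Suc step[of "n + k"] e[of "n + k"] by simp
  qed
  have bd': "d (s n) (s k) \<le> 2 * e n" if "n \<le> k" for n k
    using bd[of n "k - n"] e0[of k] that by simp
  have geo: "e n \<le> e 0 * (1/2) ^ n" for n
  proof (induction n)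
    case (Suc n) then show ?case using e[of n] by simp
  qed simp
  have small: "\<exists>N. 2 * e N < \<epsilon>" if "\<epsilon> > 0" for \<epsilon>
  proof -
    have "(\<lambda>n. 2 * (e 0 * (1/2) ^ n)) \<longlonglongrightarrow> 2 * (e 0 * 0)"
      by (intro tendsto_intros LIMSEQ_realpow_zero) auto
    then have "eventually (\<lambda>n. 2 * (e 0 * (1/2) ^ n) < \<epsilon>) sequentially"
      using that by (intro order_tendstoD(2)) auto
    then obtain N where "2 * (e 0 * (1/2) ^ N) < \<epsilon>"
      by (auto simp: eventually_sequentially)
    then show ?thesis using geo[of N] by (intro exI[of _ N]) linarith
  qed
  have "MCauchy s"
    unfolding MCauchy_def
  proof (intro conjI allI impI)
    fix \<epsilon> :: real assume "\<epsilon> > 0"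
    then obtain N where N: "2 * e N < \<epsilon> / 2" using small[of "\<epsilon> / 2"] by auto
    have "d (s n) (s n') < \<epsilon>" if "N \<le> n" "N \<le> n'" for n n'
    proof -
      have "d (s n) (s n') \<le> d (s N) (s n) + d (s N) (s n')"
        using s triangle''[of "s n" "s n'" "s N"] commute by (metis triangle)
      then show ?thesis using bd'[OF that(1)] bd'[OF that(2)] N by linarith
    qed
    then show "\<exists>N. \<forall>n n'. N \<le> n \<longrightarrow> N \<le> n' \<longrightarrow> d (s n) (s n') < \<epsilon>" by blast
  qed (use s in auto)
  then obtain l where l: "limitin mtopology s l sequentially"
    using \<open>mcomplete\<close> by (auto simp: mcomplete_def)
  then have lM: "l \<in> M" using limitin_mspace by blast
  have "d (s n) l \<le> 2 * e n" for n
  proof (rule field_le_epsilon)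
    fix \<epsilon> :: real assume "\<epsilon> > 0"
    then obtain N where "\<forall>k\<ge>N. d (s k) l < \<epsilon>"
      using l unfolding limit_metric_sequentially by metis
    then have "d (s (max n N)) l < \<epsilon>" by simp
    moreover have "d (s n) l \<le> d (s n) (s (max n N)) + d (s (max n N)) l"
      using s lM triangle by blast
    ultimately show "d (s n) l \<le> 2 * e n + \<epsilon>" using bd'[of n "max n N"] by simp
  qed
  then show ?thesis using l lM by blast
qed

locale completely_metrized_group = group G for G (structure) +
  fixes T :: "'a topology" and m :: "'a \<Rightarrow> 'a \<Rightarrow> real"
  assumes continuous_map_multiplication:
      "continuous_map (prod_topology T T) T (\<lambda>(x, y). x \<otimes> y)"
    and continuous_map_inversion: "continuous_map T T (\<lambda>x. inv x)"
    and metric_space_m: "Metric_space (carrier G) m"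
    and complete_m: "Metric_space.mcomplete (carrier G) m"
    and T_eq: "T = Metric_space.mtopology (carrier G) m"
    and second_countable_T: "second_countable T"
begin

sublocale m: Metric_space "carrier G" m
  by (rule metric_space_m)

lemma topspace_T [simp]: "topspace T = carrier G"
  by (simp add: T_eq)

lemma completely_metrizable_T: "completely_metrizable_space T"
  using complete_m m.completely_metrizable_space_mtopology T_eq by blast

lemma openin_T_ball:
  assumes "x \<in> carrier G"
  shows "openin T {y \<in> carrier G. m x y < r}"
proof -
  have "{y \<in> carrier G. m x y < r} = m.mball x r" using assms by auto
  then show ?thesis by (simp add: T_eq)
qed

lemma openin_T_obtain_ball:
  assumes "openin T U" "x \<in> U"
  obtains r where "r > 0" "\<And>y. y \<in> carrier G \<Longrightarrow> m x y < r \<Longrightarrow> y \<in> U"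
proof -
  obtain r where "r > 0" "m.mball x r \<subseteq> U" "x \<in> carrier G"
    using assms unfolding T_eq m.openin_mtopology by blast
  then show thesis using that[of r] by (auto simp: m.mball_def)
qed

lemma continuous_map_mult [continuous_intros]:
  assumes "continuous_map X T f" "continuous_map X T g"
  shows "continuous_map X T (\<lambda>x. f x \<otimes> g x)"
  using continuous_map_compose[OF continuous_map_pairedI[OF assms] continuous_map_multiplication]
  by (simp add: o_def)

lemma continuous_map_inv [continuous_intros]:
  assumes "continuous_map X T f"
  shows "continuous_map X T (\<lambda>x. inv (f x))"
  using continuous_map_compose[OF assms continuous_map_inversion] by (simp add: o_def)

lemma open_map_left_translation:
  assumes "a \<in> carrier G"
  shows "open_map T T (\<lambda>x. a \<otimes> x)"
proof -
  have "homeomorphic_maps T T (\<lambda>x. a \<otimes> x) (\<lambda>x. inv a \<otimes> x)"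
    unfolding homeomorphic_maps_def using assms
    by (auto intro!: continuous_intros simp: inv_solve_left' m_assoc[symmetric])
  then show ?thesis using homeomorphic_maps_imp_map homeomorphic_imp_open_map by blast
qed

lemma open_map_inversion: "open_map T T (\<lambda>x. inv x)"
proof -
  have "homeomorphic_maps T T (\<lambda>x. inv x) (\<lambda>x. inv x)"
    unfolding homeomorphic_maps_def
    by (auto intro!: continuous_intros)
  then show ?thesis using homeomorphic_maps_imp_map homeomorphic_imp_open_map by blast
qed

lemma meagre_left_quotient:
  assumes "meagre_in T A" "a \<in> carrier G"
  shows "meagre_in T {x \<in> carrier G. inv a \<otimes> x \<in> A}"
  using meagre_in_open_map_vimage[OF _ open_map_left_translation assms(1), of "inv a"] assms(2)
  by (simp add: continuous_intros)

lemma meagre_right_quotient: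
  assumes "meagre_in T A" "a \<in> carrier G"
  shows "meagre_in T {x \<in> carrier G. inv x \<otimes> a \<in> A}"
proof -
  have "meagre_in T {x \<in> carrier G. inv x \<in> A}"
    using meagre_in_open_map_vimage[OF continuous_map_inversion open_map_inversion assms(1)] by simp
  from meagre_left_quotient[OF this assms(2)] show ?thesis
    by (rule meagre_in_subset) (auto simp: assms(2) inv_mult_group)
qed

text \<open>Points are replaced one at a time: with the others fixed, the forbidden positions of the
  next one form a finite union of meagre sets, which cannot fill a ball. Both orders of the quotient
  must be avoided because \<open>A\<close> need not be symmetric.\<close>

lemma perturb_avoiding_quotients:
  assumes "meagre_in T A" "finite I" "\<delta> > 0" "\<And>i. i \<in> I \<Longrightarrow> q i \<in> carrier G"
  shows "\<exists>q'. (\<forall>i\<in>I. q' i \<in> carrier G \<and> m (q i) (q' i) < \<delta>) \<and>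
    (\<forall>i\<in>I. \<forall>j\<in>I. i \<noteq> j \<longrightarrow> inv (q' i) \<otimes> q' j \<notin> A)"
  using assms(2,4)
proof (induction I)
  case (insert a I)
  then obtain q' where q': "\<And>i. i \<in> I \<Longrightarrow> q' i \<in> carrier G" "\<And>i. i \<in> I \<Longrightarrow> m (q i) (q' i) < \<delta>"
    "\<And>i j. i \<in> I \<Longrightarrow> j \<in> I \<Longrightarrow> i \<noteq> j \<Longrightarrow> inv (q' i) \<otimes> q' j \<notin> A"
    by (metis insertI2)
  define B where "B = (\<Union>i\<in>I. {x \<in> carrier G. inv (q' i) \<otimes> x \<in> A} \<union>
    {x \<in> carrier G. inv x \<otimes> q' i \<in> A})"
  have "meagre_in T B"
    unfolding B_def using insert.hyps(1) q'(1) assms(1)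
    by (intro meagre_in_UN meagre_in_Un meagre_left_quotient meagre_right_quotient)
      (auto intro: countable_finite)
  moreover have "\<not> meagre_in T {y \<in> carrier G. m (q a) y < \<delta>}"
    using insert.prems[of a] \<open>\<delta> > 0\<close> openin_T_ball
    by (intro Baire_not_meagre[OF completely_metrizable_T]) (auto intro!: exI[of _ "q a"])
  ultimately obtain x where x: "x \<in> carrier G" "m (q a) x < \<delta>" "x \<notin> B"
    using meagre_in_subset[of T B "{y \<in> carrier G. m (q a) y < \<delta>}"] by blast
  show ?case
  proof (intro exI[of _ "q'(a := x)"] conjI ballI impI)
    fix i j assume "i \<in> insert a I" "j \<in> insert a I" "i \<noteq> j"
    then show "inv ((q'(a := x)) i) \<otimes> (q'(a := x)) j \<notin> A"
      using q' x insert.hyps(2) unfolding B_def by (cases "i = a"; cases "j = a") auto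
  qed (use q' x insert.hyps(2) in auto)
qed simp

lemma quotient_avoids_nearby:
  assumes "closedin T C" "a \<in> carrier G" "b \<in> carrier G" "inv a \<otimes> b \<notin> C"
  shows "\<exists>r>0. \<forall>x\<in>carrier G. \<forall>y\<in>carrier G. m a x < r \<longrightarrow> m b y < r \<longrightarrow> inv x \<otimes> y \<notin> C"
proof -
  have "continuous_map (prod_topology T T) T (\<lambda>z. inv (fst z) \<otimes> snd z)"
    by (intro continuous_intros)
  moreover have "openin T (carrier G - C)"
    using assms(1) by (metis openin_diff openin_topspace topspace_T)
  ultimately have "openin (prod_topology T T)
      {z \<in> topspace (prod_topology T T). inv (fst z) \<otimes> snd z \<in> carrier G - C}"
    by (rule openin_continuous_map_preimage)
  moreover have "(a, b) \<in> {z \<in> topspace (prod_topology T T). inv (fst z) \<otimes> snd z \<in> carrier G - C}"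
    using assms(2-4) by simp
  ultimately obtain U V where UV: "openin T U" "openin T V" "a \<in> U" "b \<in> V"
    "U \<times> V \<subseteq> {z \<in> topspace (prod_topology T T). inv (fst z) \<otimes> snd z \<in> carrier G - C}"
    unfolding openin_prod_topology_alt by meson
  obtain r where r: "r > 0" "\<And>y. y \<in> carrier G \<Longrightarrow> m a y < r \<Longrightarrow> y \<in> U"
    using openin_T_obtain_ball[OF UV(1,3)] by metis
  obtain s where s: "s > 0" "\<And>y. y \<in> carrier G \<Longrightarrow> m b y < s \<Longrightarrow> y \<in> V"
    using openin_T_obtain_ball[OF UV(2,4)] by metis
  have "inv x \<otimes> y \<notin> C" if "x \<in> carrier G" "y \<in> carrier G" "m a x < min r s" "m b y < min r s" for x y
  proof -
    have "(x, y) \<in> U \<times> V" using r(2)[of x] s(2)[of y] that by simp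
    then show ?thesis using UV(5) by auto
  qed
  then show ?thesis using r(1) s(1) by (intro exI[of _ "min r s"]) auto
qed

end

section \<open>Continuum many elements whose quotients avoid a meagre set\<close>

lemma finite_uniform_radius:
  assumes "finite I" "\<And>i. i \<in> I \<Longrightarrow> \<exists>r>0::real. P i r"
    and "\<And>i r s. P i r \<Longrightarrow> s \<le> r \<Longrightarrow> P i s"
  shows "\<exists>r>0. \<forall>i\<in>I. P i r"
  using assms(1,2)
proof (induction I)
  case (insert a I)
  then obtain r s where rs: "r > 0" "\<forall>i\<in>I. P i r" "s > 0" "P a s" by (metis insert_iff)
  then have "\<forall>i\<in>insert a I. P i (min r s)"
    using assms(3) by (metis insert_iff min.cobounded1 min.cobounded2)
  then show ?case using rs by (intro exI[of _ "min r s"]) auto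
qed (auto intro: exI[of _ 1])

context completely_metrized_group
begin

text \<open>A Cantor scheme over binary words: at each level the points are perturbed until
  quotients of different words avoid one more closed piece of the cover of \<open>A\<close>, with a
  margin that survives the limit.\<close>

theorem Mycielski_quotients:
  assumes "meagre_in T A"
  obtains h :: "(nat \<Rightarrow> bool) \<Rightarrow> 'a"
  where "\<And>\<alpha>. h \<alpha> \<in> carrier G" "\<And>\<alpha> \<beta>. \<alpha> \<noteq> \<beta> \<Longrightarrow> inv (h \<alpha>) \<otimes> h \<beta> \<notin> A"
proof -
  obtain F :: "nat \<Rightarrow> 'a set" where F: "\<And>n. closedin T (F n)"
    "\<And>n. T interior_of (F n) = {}" "A \<subseteq> (\<Union>n. F n)"
    using meagre_in_closed_cover[OF assms] by metis
  define W where "W n = {s :: bool list. length s = n}" for n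
  have finW: "finite (W n)" for n
    unfolding W_def using finite_lists_length_eq[of "UNIV :: bool set" n] by simp
  define C where "C n = (\<Union>l\<le>n. F l)" for n :: nat
  have closedC: "closedin T (C n)" for n
    unfolding C_def using F(1) by (intro closedin_Union) auto
  have "meagre_in T (\<Union>l. F l)"
    using F by (intro meagre_in_UN closed_empty_interior_imp_meagre) auto
  then have meagreC: "meagre_in T (C n)" for n
    by (rule meagre_in_subset) (auto simp: C_def)
  \<comment> \<open>Separation is demanded for whole balls and not only for their centres, so that
    it passes to the limits of the branches.\<close>
  define sep where "sep n q r \<longleftrightarrow> (\<forall>s\<in>W n. \<forall>t\<in>W n. s \<noteq> t \<longrightarrow>
      (\<forall>x\<in>carrier G. \<forall>y\<in>carrier G. m (q s) x < r \<longrightarrow> m (q t) y < r \<longrightarrow> inv x \<otimes> y \<notin> C n))"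
    for n and q :: "bool list \<Rightarrow> 'a" and r
  \<comment> \<open>The state consists of centres and a common radius. A step moves a centre by less
    than a quarter of the radius and the radii halve, so the total drift is at most half a radius
    and the limit stays in every ball of its branch.\<close>
  have "\<exists>f. \<forall>n. (snd (f n) > 0 \<and> (\<forall>s\<in>W n. fst (f n) s \<in> carrier G) \<and> sep n (fst (f n)) (snd (f n))) \<and>
    (snd (f (Suc n)) \<le> snd (f n) / 2 \<and>
      (\<forall>s\<in>W (Suc n). m (fst (f n) (butlast s)) (fst (f (Suc n)) s) < snd (f n) / 4))"
  proof (rule dependent_nat_choice)
    show "\<exists>x. 0 < snd x \<and> (\<forall>s\<in>W 0. fst x s \<in> carrier G) \<and> sep 0 (fst x) (snd x)"
      by (intro exI[of _ "(\<lambda>_. \<one>, 1)"]) (auto simp: sep_def W_def)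
  next
    fix x :: "(bool list \<Rightarrow> 'a) \<times> real" and n
    assume x: "0 < snd x \<and> (\<forall>s\<in>W n. fst x s \<in> carrier G) \<and> sep n (fst x) (snd x)"
    have "fst x (butlast s) \<in> carrier G" if "s \<in> W (Suc n)" for s
      using x that by (auto simp: W_def)
    then obtain q where "(\<forall>s\<in>W (Suc n). q s \<in> carrier G \<and>
        m (fst x (butlast s)) (q s) < snd x / 4) \<and>
      (\<forall>s\<in>W (Suc n). \<forall>t\<in>W (Suc n). s \<noteq> t \<longrightarrow> inv (q s) \<otimes> q t \<notin> C (Suc n))"
      using perturb_avoiding_quotients[OF meagreC[of "Suc n"] finW[of "Suc n"],
          of "snd x / 4" "\<lambda>s. fst x (butlast s)"] x by auto
    then have q: "\<And>s. s \<in> W (Suc n) \<Longrightarrow> q s \<in> carrier G"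
      "\<And>s. s \<in> W (Suc n) \<Longrightarrow> m (fst x (butlast s)) (q s) < snd x / 4"
      "\<And>s t. s \<in> W (Suc n) \<Longrightarrow> t \<in> W (Suc n) \<Longrightarrow> s \<noteq> t \<Longrightarrow> inv (q s) \<otimes> q t \<notin> C (Suc n)"
      by blast+
    define P where "P st r \<longleftrightarrow> (fst st \<noteq> snd st \<longrightarrow> (\<forall>x\<in>carrier G. \<forall>y\<in>carrier G.
      m (q (fst st)) x < r \<longrightarrow> m (q (snd st)) y < r \<longrightarrow> inv x \<otimes> y \<notin> C (Suc n)))" for st and r :: real
    have "\<exists>r>0. \<forall>st\<in>W (Suc n) \<times> W (Suc n). P st r"
    proof (rule finite_uniform_radius)
      fix st assume st: "st \<in> W (Suc n) \<times> W (Suc n)"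
      show "\<exists>r>0. P st r"
      proof (cases "fst st = snd st")
        case False
        then show ?thesis
          unfolding P_def using st q quotient_avoids_nearby[OF closedC[of "Suc n"], of "q (fst st)" "q (snd st)"]
          by auto
      qed (auto simp: P_def intro: exI[of _ 1])
    next
      fix st r s assume "P st r" "s \<le> r"
      then show "P st s" unfolding P_def using less_le_trans by blast
    qed (use finW in auto)
    then obtain r where r: "r > 0" "\<forall>st\<in>W (Suc n) \<times> W (Suc n). P st r" by blast
    have "sep (Suc n) q (min r (snd x / 2))"
      using r(2) unfolding sep_def P_def by fastforce
    then show "\<exists>y. (0 < snd y \<and> (\<forall>s\<in>W (Suc n). fst y s \<in> carrier G) \<and> sep (Suc n) (fst y) (snd y)) \<and>
      snd y \<le> snd x / 2 \<and> (\<forall>s\<in>W (Suc n). m (fst x (butlast s)) (fst y s) < snd x / 4)"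
      using q r(1) x by (intro exI[of _ "(q, min r (snd x / 2))"]) auto
  qed
  then obtain f where f: "\<And>n. snd (f n) > 0" "\<And>n s. s \<in> W n \<Longrightarrow> fst (f n) s \<in> carrier G"
    "\<And>n. sep n (fst (f n)) (snd (f n))" "\<And>n. snd (f (Suc n)) \<le> snd (f n) / 2"
    "\<And>n s. s \<in> W (Suc n) \<Longrightarrow> m (fst (f n) (butlast s)) (fst (f (Suc n)) s) < snd (f n) / 4"
    by (metis (no_types, lifting))
  define w where "w \<alpha> n = map \<alpha> [0..<n]" for \<alpha> :: "nat \<Rightarrow> bool" and n
  have wW: "w \<alpha> n \<in> W n" and wS: "butlast (w \<alpha> (Suc n)) = w \<alpha> n" for \<alpha> n
    by (simp_all add: w_def W_def)
  have "\<exists>l\<in>carrier G. \<forall>n. m (fst (f n) (w \<alpha> n)) l \<le> 2 * (snd (f n) / 4)" for \<alpha>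
  proof -
    have "m (fst (f n) (w \<alpha> n)) (fst (f (Suc n)) (w \<alpha> (Suc n))) \<le> snd (f n) / 4" for n
      using f(5)[OF wW[of \<alpha> "Suc n"]] wS by simp
    moreover have "snd (f (Suc n)) / 4 \<le> snd (f n) / 4 / 2" for n
      using f(4)[of n] by simp
    ultimately have "\<exists>l\<in>carrier G. limitin m.mtopology (\<lambda>n. fst (f n) (w \<alpha> n)) l sequentially \<and>
        (\<forall>n. m (fst (f n) (w \<alpha> n)) l \<le> 2 * (snd (f n) / 4))"
      by (intro m.geometric_sequence_converges complete_m f(2) wW)
    then show ?thesis by blast
  qed
  then obtain h where h: "\<And>\<alpha>. h \<alpha> \<in> carrier G"
    "\<And>\<alpha> n. m (fst (f n) (w \<alpha> n)) (h \<alpha>) \<le> 2 * (snd (f n) / 4)"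
    by metis
  show thesis
  proof (rule that[of h])
    fix \<alpha> \<beta> :: "nat \<Rightarrow> bool" assume "\<alpha> \<noteq> \<beta>"
    then obtain N where N: "\<alpha> N \<noteq> \<beta> N" by blast
    have "inv (h \<alpha>) \<otimes> h \<beta> \<notin> F l" for l
    proof -
      \<comment> \<open>At this level the two words already differ and \<open>F l\<close> is part of
        \<open>C n\<close>.\<close>
      define n where "n = max (Suc N) l"
      have "w \<alpha> n ! N = \<alpha> N" "w \<beta> n ! N = \<beta> N" by (auto simp: w_def n_def)
      then have "w \<alpha> n \<noteq> w \<beta> n" using N by metis
      moreover have "m (fst (f n) (w \<gamma> n)) (h \<gamma>) < snd (f n)" for \<gamma>
        using h(2)[of n \<gamma>] f(1)[of n] by simp
      ultimately have "inv (h \<alpha>) \<otimes> h \<beta> \<notin> C n"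
        using f(3)[of n] wW h(1) unfolding sep_def by blast
      then show ?thesis by (auto simp: C_def n_def)
    qed
    then show "inv (h \<alpha>) \<otimes> h \<beta> \<notin> A" using F(3) by blast
  qed (rule h(1))
qed

end

lemma everywhere_nonmeagre_mono:
  assumes "everywhere_nonmeagre X S U" "S \<subseteq> R"
  shows "everywhere_nonmeagre X R U"
  unfolding everywhere_nonmeagre_def
proof (intro allI impI notI)
  fix W assume "openin X W \<and> W \<noteq> {} \<and> W \<subseteq> U" "meagre_in X (R \<inter> W)"
  then show False
    using assms(1) meagre_in_subset[OF _ Int_mono[OF assms(2) order_refl]]
    by (auto simp: everywhere_nonmeagre_def)
qed

section \<open>Conjugation in a topometric group\<close>

locale metrized_topometric_group = completely_metrized_group G T m
  for G (structure) and T :: "'a topology" and m +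
  fixes d :: "'a \<Rightarrow> 'a \<Rightarrow> real"
  assumes topometric: "topometric_space T d"
    and bi_invariant_d: "bi_invariant G d"
begin

sublocale d: Metric_space "carrier G" d
  using topometric by (simp add: topometric_space_def)

lemma d_left: "k \<in> carrier G \<Longrightarrow> x \<in> carrier G \<Longrightarrow> y \<in> carrier G \<Longrightarrow> d (k \<otimes> x) (k \<otimes> y) = d x y"
  and d_right: "k \<in> carrier G \<Longrightarrow> x \<in> carrier G \<Longrightarrow> y \<in> carrier G \<Longrightarrow> d (x \<otimes> k) (y \<otimes> k) = d x y"
  using bi_invariant_d by (simp_all add: bi_invariant_def)

text \<open>Lower semicontinuity in sequential form. The limits are those of \<open>T\<close>; the
  sequences need not converge in \<open>d\<close>.\<close>

lemma d_limit_le: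
  assumes "limitin T x l sequentially" "limitin T y k sequentially"
    and "\<And>n. d (x n) (y n) \<le> r" "\<And>n. x n \<in> carrier G" "\<And>n. y n \<in> carrier G"
  shows "d l k \<le> r"
proof -
  let ?C = "{(x, y). x \<in> carrier G \<and> y \<in> carrier G \<and> d x y \<le> r}"
  have C: "closedin (prod_topology T T) ?C"
    using topometric by (simp add: topometric_space_def)
  have lim: "limitin (prod_topology T T) (\<lambda>n. (x n, y n)) (l, k) sequentially"
    using assms(1,2) by (simp add: limitin_pairwise o_def)
  have "(l, k) \<in> ?C"
    by (rule limitin_closedin[OF lim C]) (use assms in auto)
  then show ?thesis by simp
qed

definition cj :: "'a \<Rightarrow> 'a \<Rightarrow> 'a" where
  "cj k x = k \<otimes> x \<otimes> inv k"

lemma cj_closed [simp]: "k \<in> carrier G \<Longrightarrow> x \<in> carrier G \<Longrightarrow> cj k x \<in> carrier G"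
  by (simp add: cj_def)

lemma cj_one [simp]: "x \<in> carrier G \<Longrightarrow> cj \<one> x = x"
  by (simp add: cj_def)

lemma cj_mult:
  "k \<in> carrier G \<Longrightarrow> l \<in> carrier G \<Longrightarrow> x \<in> carrier G \<Longrightarrow> cj (k \<otimes> l) x = cj k (cj l x)"
  by (simp add: cj_def inv_mult_group m_assoc)

lemma d_cj [simp]:
  "k \<in> carrier G \<Longrightarrow> x \<in> carrier G \<Longrightarrow> y \<in> carrier G \<Longrightarrow> d (cj k x) (cj k y) = d x y"
  by (simp add: cj_def d_left d_right)

lemma d_cj_inv_left:
  "k \<in> carrier G \<Longrightarrow> l \<in> carrier G \<Longrightarrow> x \<in> carrier G \<Longrightarrow> y \<in> carrier G \<Longrightarrow>
    d (cj (inv k \<otimes> l) x) y = d (cj l x) (cj k y)"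
  using d_cj[of k "cj (inv k \<otimes> l) x" y] by (simp add: cj_mult[symmetric] inv_solve_left' m_assoc[symmetric])

lemma limitin_cj:
  assumes "limitin T g l sequentially" "x \<in> carrier G"
  shows "limitin T (\<lambda>n. cj (g n) x) (cj l x) sequentially"
proof -
  have "continuous_map T T (\<lambda>k. cj k x)"
    unfolding cj_def using assms(2) by (auto intro!: continuous_intros)
  from continuous_map_limit[OF this assms(1)] show ?thesis by (simp add: o_def)
qed

section \<open>Local orbits of tuples under diagonal conjugation\<close>

abbreviation tuples :: "nat \<Rightarrow> (nat \<Rightarrow> 'a) topology" where
  "tuples n \<equiv> power_topology T n"

lemma topspace_tuples_nth: "x \<in> topspace (tuples n) \<Longrightarrow> i < n \<Longrightarrow> x i \<in> carrier G"
  by (auto simp: topspace_power_topology PiE_def)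

lemma not_meagre_tuples: "openin (tuples n) U \<Longrightarrow> U \<noteq> {} \<Longrightarrow> \<not> meagre_in (tuples n) U"
  by (rule Baire_not_meagre[OF completely_metrizable_power_topology[OF completely_metrizable_T]])

lemma openin_tuples_ball:
  assumes "x \<in> topspace (tuples n)"
  shows "openin (tuples n) {y \<in> topspace (tuples n). \<forall>i<n. m (x i) (y i) < r}"
proof -
  have "openin (tuples n) {y \<in> topspace (tuples n). y i \<in> {b \<in> carrier G. m (x i) b < r}}"
    if "i < n" for i
  proof (rule openin_continuous_map_preimage)
    show "continuous_map (tuples n) T (\<lambda>y. y i)"
      unfolding power_topology_def using that by (intro continuous_map_product_projection) auto
    show "openin T {b \<in> carrier G. m (x i) b < r}"
      by (intro openin_T_ball topspace_tuples_nth[OF assms that])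
  qed
  \<comment> \<open>For \<open>n = 0\<close> the intersection over the empty index set is
    \<open>UNIV\<close>, hence the extra intersection with the space.\<close>
  then have "openin (tuples n) (topspace (tuples n) \<inter>
      (\<Inter>i\<in>{..<n}. {y \<in> topspace (tuples n). y i \<in> {b \<in> carrier G. m (x i) b < r}}))"
    by (cases "n = 0") (auto intro!: openin_Int openin_INT)
  moreover have "topspace (tuples n) \<inter>
      (\<Inter>i\<in>{..<n}. {y \<in> topspace (tuples n). y i \<in> {b \<in> carrier G. m (x i) b < r}})
    = {y \<in> topspace (tuples n). \<forall>i<n. m (x i) (y i) < r}"
    using topspace_tuples_nth by auto
  ultimately show ?thesis by simp
qed

text \<open>With \<open>V = carrier G\<close> and a positive tolerance this is the thickened orbit
  from the definition of ample generics; a small \<open>V\<close> admits only conjugations close to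
  the identity.\<close>

definition local_orbit :: "nat \<Rightarrow> 'a set \<Rightarrow> real \<Rightarrow> (nat \<Rightarrow> 'a) \<Rightarrow> (nat \<Rightarrow> 'a) set" where
  "local_orbit n V \<epsilon> z = {y \<in> topspace (tuples n). \<exists>v\<in>V. \<forall>i<n. d (y i) (cj v (z i)) < \<epsilon>}"

text \<open>The Baire property of analytic sets is not available, so instead of asking a local orbit to be
  comeagre near \<open>z\<close> we only ask it to be non-meagre in every open subset of a neighbourhood of \<open>z\<close>;
  by the Banach category theorem this holds at almost every point of any set.\<close>

definition turbulent :: "nat \<Rightarrow> (nat \<Rightarrow> 'a) \<Rightarrow> bool" where
  "turbulent n z \<longleftrightarrow> z \<in> topspace (tuples n) \<and>
    (\<forall>V \<epsilon>. openin T V \<and> \<one> \<in> V \<and> \<epsilon> > 0 \<longrightarrow>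
      (\<exists>U. openin (tuples n) U \<and> z \<in> U \<and> everywhere_nonmeagre (tuples n) (local_orbit n V \<epsilon> z) U))"

lemma turbulent_topspace: "turbulent n z \<Longrightarrow> z \<in> topspace (tuples n)"
  by (simp add: turbulent_def)

text \<open>Both points lie near the same piece of an orbit. Going back from \<open>z\<close> by
  \<open>inv w'\<close> and on to \<open>y\<close> by \<open>w\<close> costs half the tolerance each
  time, because conjugation preserves \<open>d\<close>.\<close>

lemma local_orbit_translates:
  assumes "y \<in> local_orbit n W (\<epsilon>/2) (\<lambda>i. cj q (g i))" "z \<in> local_orbit n W (\<epsilon>/2) (\<lambda>i. cj q (g i))"
    and "g \<in> topspace (tuples n)" "q \<in> carrier G" "W \<subseteq> carrier G"
    and V: "\<And>w w'. w \<in> W \<Longrightarrow> w' \<in> W \<Longrightarrow> w \<otimes> inv w' \<in> V"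
  shows "y \<in> local_orbit n V \<epsilon> z"
proof -
  obtain w w' where w: "w \<in> W" "w' \<in> W" "\<forall>i<n. d (y i) (cj w (cj q (g i))) < \<epsilon>/2"
    "\<forall>i<n. d (z i) (cj w' (cj q (g i))) < \<epsilon>/2"
    using assms(1,2) unfolding local_orbit_def by blast
  have y: "y \<in> topspace (tuples n)" and z: "z \<in> topspace (tuples n)"
    using assms(1,2) by (simp_all add: local_orbit_def)
  have wc: "w \<in> carrier G" "w' \<in> carrier G" using w assms(5) by auto
  have "d (y i) (cj (w \<otimes> inv w') (z i)) < \<epsilon>" if i: "i < n" for i
  proof -
    have c: "y i \<in> carrier G" "z i \<in> carrier G" "g i \<in> carrier G" "cj q (g i) \<in> carrier G"
      using y z assms(3,4) topspace_tuples_nth i by auto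
    have "d (cj w (cj q (g i))) (cj (w \<otimes> inv w') (z i)) = d (cj w' (cj q (g i))) (z i)"
    proof -
      have "cj w (cj q (g i)) = cj (w \<otimes> inv w') (cj w' (cj q (g i)))"
        using wc c by (simp add: cj_mult[symmetric] m_assoc)
      then show ?thesis using wc c by simp
    qed
    moreover have "d (y i) (cj (w \<otimes> inv w') (z i)) \<le> d (y i) (cj w (cj q (g i)))
        + d (cj w (cj q (g i))) (cj (w \<otimes> inv w') (z i))"
      using wc c by (intro d.triangle) auto
    ultimately show ?thesis using w(3,4) i by (fastforce simp: d.commute)
  qed
  then show ?thesis using y V[OF w(1,2)] by (auto simp: local_orbit_def)
qed

lemma quotient_neighbourhood:
  assumes "openin T V" "\<one> \<in> V"
  shows "\<exists>r>0. \<forall>x\<in>carrier G. \<forall>y\<in>carrier G. m \<one> x < r \<longrightarrow> m \<one> y < r \<longrightarrow> inv x \<otimes> y \<in> V"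
proof -
  have "closedin T (carrier G - V)" using assms(1) by (metis openin_closedin_eq topspace_T)
  then obtain r where "r > 0" "\<forall>x\<in>carrier G. \<forall>y\<in>carrier G. m \<one> x < r \<longrightarrow> m \<one> y < r \<longrightarrow> inv x \<otimes> y \<notin> carrier G - V"
    using quotient_avoids_nearby[of "carrier G - V" \<one> \<one>] assms(2) by auto
  then show ?thesis by (intro exI[of _ r]) auto
qed

text \<open>For each of countably many tolerances fix a tuple with comeagre thickened orbit. A
  countable dense set \<open>Q\<close> and a small neighbourhood \<open>W k\<close> of the identity
  cut that orbit into countably many pieces \<open>S k q\<close>; by the Banach category theorem,
  almost every point of a piece has a neighbourhood in which the piece is everywhere non-meagre. A
  piece through \<open>z\<close> is contained in a local orbit of \<open>z\<close>, so turbulence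
  can fail only on countably many meagre sets.\<close>

lemma meagre_not_turbulent:
  assumes ample: "ample_generics G T d"
  shows "meagre_in (tuples n) {z \<in> topspace (tuples n). \<not> turbulent n z}"
proof -
  define \<epsilon> where "\<epsilon> k = 1 / (real k + 1)" for k
  have \<epsilon>0: "\<epsilon> k > 0" for k by (simp add: \<epsilon>_def)
  have "\<exists>g\<in>topspace (tuples n). meagre_in (tuples n) (topspace (tuples n) - local_orbit n (carrier G) (\<epsilon> k / 2) g)" for k
  proof -
    obtain g where g: "g \<in> topspace (tuples n)" "comeagre_in (tuples n)
       (eps_nbhd (topspace (tuples n)) (sup_dist d n) ((\<lambda>k. diag_conj G n k g) ` carrier G) (\<epsilon> k / 2))"
      using ample \<epsilon>0[of k] unfolding ample_generics_def by (meson half_gt_zero)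
    have sub: "eps_nbhd (topspace (tuples n)) (sup_dist d n) ((\<lambda>k. diag_conj G n k g) ` carrier G) (\<epsilon> k / 2)
      \<subseteq> local_orbit n (carrier G) (\<epsilon> k / 2) g"
    proof
      fix y assume "y \<in> eps_nbhd (topspace (tuples n)) (sup_dist d n) ((\<lambda>k. diag_conj G n k g) ` carrier G) (\<epsilon> k / 2)"
      then have y: "y \<in> topspace (tuples n)"
        and lt: "(INF a\<in>(\<lambda>k. diag_conj G n k g) ` carrier G. sup_dist d n y a) < \<epsilon> k / 2"
        by (simp_all add: eps_nbhd_def)
      \<comment> \<open>The \<open>0\<close> inserted into the maximum bounds all distances below,
        so an infimum below the tolerance is witnessed by an actual point of the orbit.\<close>
      have ge0: "0 \<le> sup_dist d n y a" for a
        unfolding sup_dist_def by (intro Max_ge) auto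
      have "bdd_below (sup_dist d n y ` (\<lambda>k. diag_conj G n k g) ` carrier G)"
        using ge0 by (intro bdd_belowI[of _ 0]) auto
      then obtain l where l: "l \<in> carrier G" "sup_dist d n y (diag_conj G n l g) < \<epsilon> k / 2"
        using lt by (subst (asm) cInf_less_iff) auto
      have "d (y i) (cj l (g i)) < \<epsilon> k / 2" if "i < n" for i
      proof -
        have "d (y i) (diag_conj G n l g i) \<le> sup_dist d n y (diag_conj G n l g)"
          unfolding sup_dist_def using that by (intro Max_ge) auto
        then show ?thesis using l(2) that by (simp add: diag_conj_def cj_def)
      qed
      then show "y \<in> local_orbit n (carrier G) (\<epsilon> k / 2) g"
        using y l(1) by (auto simp: local_orbit_def)
    qed
    show ?thesis
      using g(2) meagre_in_subset[OF _ Diff_mono[OF order_refl sub]]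
      by (intro bexI[of _ g] g(1)) (simp add: comeagre_in_def)
  qed
  then obtain g where g: "\<And>k. g k \<in> topspace (tuples n)"
    "\<And>k. meagre_in (tuples n) (topspace (tuples n) - local_orbit n (carrier G) (\<epsilon> k / 2) (g k))"
    by metis
  have "\<exists>r>0. \<forall>x\<in>carrier G. \<forall>y\<in>carrier G. m \<one> x < r \<longrightarrow> m \<one> y < r \<longrightarrow> m \<one> (inv x \<otimes> y) < \<epsilon> k" for k
  proof -
    have "\<one> \<in> {y \<in> carrier G. m \<one> y < \<epsilon> k}" using \<epsilon>0 by simp
    from quotient_neighbourhood[OF openin_T_ball[OF one_closed] this] show ?thesis by simp
  qed
  then obtain r where r: "\<And>k. r k > 0"
    "\<And>k x y. x \<in> carrier G \<Longrightarrow> y \<in> carrier G \<Longrightarrow> m \<one> x < r k \<Longrightarrow> m \<one> y < r k \<Longrightarrow> m \<one> (inv x \<otimes> y) < \<epsilon> k"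
    by metis
  \<comment> \<open>Defined through inverses because products \<open>w \<otimes> inv w'\<close> must
    be small, while \<open>r\<close> controls quotients of the form
    \<open>inv x \<otimes> y\<close>.\<close>
  define W where "W k = {w \<in> carrier G. m \<one> (inv w) < r k}" for k
  have W: "W k \<subseteq> carrier G" for k by (auto simp: W_def)
  have openW: "openin T (W k)" for k
    using openin_continuous_map_preimage[OF continuous_map_inversion openin_T_ball[of \<one> "r k"]]
    by (simp add: W_def cong: conj_cong)
  have WW: "w \<otimes> inv w' \<in> {v \<in> carrier G. m \<one> v < \<epsilon> k}" if "w \<in> W k" "w' \<in> W k" for w w' k
    using r(2)[of "inv w" "inv w'" k] that by (simp add: W_def)
  obtain Q where Q: "countable Q" "Q \<subseteq> carrier G" "T closure_of Q = carrier G"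
    using second_countable_imp_separable_space[OF second_countable_T] by (auto simp: separable_space_def)
  define S where "S k q = local_orbit n (W k) (\<epsilon> k / 2) (\<lambda>i. cj q (g k i))" for k q
  define bad where "bad k q = {z \<in> S k q. \<not> (\<exists>U. openin (tuples n) U \<and> z \<in> U \<and>
      everywhere_nonmeagre (tuples n) (S k q) U)}" for k q
  have "meagre_in (tuples n) (bad k q)" for k q
    unfolding bad_def
    by (intro meagre_in_not_locally_nonmeagre second_countable_power_topology second_countable_T)
      (auto simp: S_def local_orbit_def)
  then have "meagre_in (tuples n) (\<Union>k. (topspace (tuples n) - local_orbit n (carrier G) (\<epsilon> k / 2) (g k)) \<union>
      (\<Union>q\<in>Q. bad k q))"
    using Q(1) g(2) by (intro meagre_in_UN meagre_in_Un) auto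
  moreover have "turbulent n z" if z: "z \<in> topspace (tuples n)"
    and zb: "z \<notin> (\<Union>k. (topspace (tuples n) - local_orbit n (carrier G) (\<epsilon> k / 2) (g k)) \<union> (\<Union>q\<in>Q. bad k q))"
  for z
    unfolding turbulent_def
  proof (intro conjI allI impI z)
    fix V and e :: real assume V: "openin T V \<and> \<one> \<in> V \<and> 0 < e"
    obtain s where s: "s > 0" "\<And>y. y \<in> carrier G \<Longrightarrow> m \<one> y < s \<Longrightarrow> y \<in> V"
      using V openin_T_obtain_ball[of V \<one>] by metis
    obtain k where k: "\<epsilon> k < min s e"
      using reals_Archimedean[of "min s e"] s(1) V
      by (auto simp: \<epsilon>_def inverse_eq_divide add.commute)
    have "z \<in> local_orbit n (carrier G) (\<epsilon> k / 2) (g k)" using z zb by blast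
    then obtain l where l: "l \<in> carrier G" "\<forall>i<n. d (z i) (cj l (g k i)) < \<epsilon> k / 2"
      by (auto simp: local_orbit_def)
    \<comment> \<open>The \<open>q\<close> with \<open>l \<otimes> inv q\<close> in
      \<open>W k\<close> form an open neighbourhood of \<open>l\<close>, so one of them lies in
      \<open>Q\<close>; then \<open>l\<close> factors as an element of \<open>W k\<close> times
      \<open>q\<close>.\<close>
    have "continuous_map T T (\<lambda>q. l \<otimes> inv q)"
      by (rule continuous_map_mult) (use l(1) continuous_map_inversion in auto)
    from openin_continuous_map_preimage[OF this openW]
    have o: "openin T {q \<in> topspace T. l \<otimes> inv q \<in> W k}" .
    have lU: "l \<in> {q \<in> topspace T. l \<otimes> inv q \<in> W k}"
      using l(1) r(1) by (simp add: W_def)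
    have "\<forall>U. l \<in> U \<and> openin T U \<longrightarrow> (\<exists>y. y \<in> Q \<and> y \<in> U)"
      using Q(3) l(1) in_closure_of[of l T Q] by simp
    from this[rule_format, OF conjI[OF lU o]]
    obtain q where q: "q \<in> Q" "l \<otimes> inv q \<in> W k" by auto
    have qc: "q \<in> carrier G" using q Q by auto
    have "cj (l \<otimes> inv q) (cj q (g k i)) = cj l (g k i)" if "i < n" for i
      using that topspace_tuples_nth[OF g(1)] l(1) qc by (simp add: cj_mult[symmetric] m_assoc)
    then have zS: "z \<in> S k q"
      unfolding S_def local_orbit_def using z l(2) q(2) by (auto intro!: bexI[of _ "l \<otimes> inv q"])
    then obtain U where U: "openin (tuples n) U" "z \<in> U" "everywhere_nonmeagre (tuples n) (S k q) U"
      using zb q(1) unfolding bad_def by blast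
    have "S k q \<subseteq> local_orbit n V e z"
    proof
      fix y assume y: "y \<in> S k q"
      have "y \<in> local_orbit n {v \<in> carrier G. m \<one> v < \<epsilon> k} (\<epsilon> k) z"
        using local_orbit_translates[OF y[unfolded S_def] zS[unfolded S_def] g(1) qc W WW] .
      then obtain v where v: "y \<in> topspace (tuples n)" "v \<in> carrier G" "m \<one> v < \<epsilon> k"
        "\<forall>i<n. d (y i) (cj v (z i)) < \<epsilon> k"
        by (auto simp: local_orbit_def)
      have "v \<in> V" using s(2)[of v] v(2,3) k by simp
      moreover have "\<forall>i<n. d (y i) (cj v (z i)) < e" using v(4) k by auto
      ultimately show "y \<in> local_orbit n V e z"
        using v(1) by (auto simp: local_orbit_def)
    qed
    then have "everywhere_nonmeagre (tuples n) (local_orbit n V e z) U"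
      by (rule everywhere_nonmeagre_mono[OF U(3)])
    then show "\<exists>U. openin (tuples n) U \<and> z \<in> U \<and> everywhere_nonmeagre (tuples n) (local_orbit n V e z) U"
      using U by blast
  qed
  ultimately show ?thesis
    by (elim meagre_in_subset) blast
qed

section \<open>An approximate Effros theorem\<close>

text \<open>A neighbourhood of the identity that depends on \<open>g\<close>: as \<open>m\<close>
  need not be invariant, a factor counts as small when it moves the current product \<open>g\<close>
  by little. This keeps the successive products Cauchy.\<close>

definition shift_nbhd :: "'a \<Rightarrow> real \<Rightarrow> 'a set" where
  "shift_nbhd g r = {v \<in> carrier G. m g (v \<otimes> g) < r}"

lemma openin_shift_nbhd:
  assumes "g \<in> carrier G"
  shows "openin T (shift_nbhd g r)"
proof -
  have "continuous_map T T (\<lambda>v. v \<otimes> g)"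
    by (rule continuous_map_mult) (use assms in auto)
  from openin_continuous_map_preimage[OF this openin_T_ball[OF assms]]
  have "openin T {v \<in> topspace T. v \<otimes> g \<in> {y \<in> carrier G. m g y < r}}" .
  moreover have "{v \<in> topspace T. v \<otimes> g \<in> {y \<in> carrier G. m g y < r}} = shift_nbhd g r"
    using assms by (auto simp: shift_nbhd_def)
  ultimately show ?thesis by simp
qed

lemma one_in_shift_nbhd: "g \<in> carrier G \<Longrightarrow> r > 0 \<Longrightarrow> \<one> \<in> shift_nbhd g r"
  by (simp add: shift_nbhd_def)

text \<open>The state before a back-and-forth step. Each pair is a tuple together with the product
  of the group elements that produced it; \<open>p\<close> is moved next, and its small local orbit
  is non-meagre all around the tuple of \<open>q\<close>, so it can be brought as close to that
  tuple as desired.\<close>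

definition linked :: "nat \<Rightarrow> real \<Rightarrow> (nat \<Rightarrow> 'a) \<times> 'a \<Rightarrow> (nat \<Rightarrow> 'a) \<times> 'a \<Rightarrow> bool" where
  "linked n e p q \<longleftrightarrow> turbulent n (fst p) \<and> snd p \<in> carrier G \<and> turbulent n (fst q) \<and> snd q \<in> carrier G \<and>
    (\<exists>U. openin (tuples n) U \<and> fst q \<in> U \<and>
      everywhere_nonmeagre (tuples n) (local_orbit n (shift_nbhd (snd p) e) e (fst p)) U)"

text \<open>The new tuple is a turbulent point of the local orbit of \<open>a\<close> in three
  neighbourhoods of \<open>b\<close>: in \<open>U\<close> that orbit is everywhere non-meagre,
  \<open>U'\<close> allows \<open>b\<close> to be moved towards the new tuple at the next tolerance,
  and the ball \<open>B\<close> keeps the tuples Cauchy in \<open>m\<close>.\<close>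

lemma linked_step:
  assumes ample: "ample_generics G T d" and "linked n e (a, g) (b, h)" "e > 0" "e' > 0"
  obtains c v where "linked n e' (b, h) (c, v \<otimes> g)" "v \<in> carrier G" "m g (v \<otimes> g) < e"
    "\<And>i. i < n \<Longrightarrow> d (c i) (cj v (a i)) < e" "\<And>i. i < n \<Longrightarrow> m (b i) (c i) < e"
proof -
  from assms(2) obtain U where a: "turbulent n a" "g \<in> carrier G" and b: "turbulent n b" "h \<in> carrier G"
    and U: "openin (tuples n) U" "b \<in> U"
      "everywhere_nonmeagre (tuples n) (local_orbit n (shift_nbhd g e) e a) U"
    by (auto simp: linked_def)
  obtain U' where U': "openin (tuples n) U'" "b \<in> U'"
    "everywhere_nonmeagre (tuples n) (local_orbit n (shift_nbhd h e') e' b) U'"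
    using b(1) openin_shift_nbhd[OF b(2), of e'] one_in_shift_nbhd[OF b(2) \<open>e' > 0\<close>] \<open>e' > 0\<close>
    unfolding turbulent_def by meson
  have bt: "b \<in> topspace (tuples n)" by (rule turbulent_topspace[OF b(1)])
  define B where "B = {y \<in> topspace (tuples n). \<forall>i<n. m (b i) (y i) < e}"
  have "openin (tuples n) (U \<inter> (U' \<inter> B))"
    unfolding B_def by (intro openin_Int U(1) U'(1) openin_tuples_ball bt)
  moreover have "b \<in> U \<inter> (U' \<inter> B)"
    using U(2) U'(2) bt topspace_tuples_nth[OF bt] \<open>e > 0\<close> by (simp add: B_def)
  ultimately obtain c where c: "c \<in> local_orbit n (shift_nbhd g e) e a" "c \<in> U \<inter> (U' \<inter> B)"
    "c \<notin> {z \<in> topspace (tuples n). \<not> turbulent n z}"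
    using everywhere_nonmeagre_meets[OF U(3), of "U \<inter> (U' \<inter> B)", OF _ _ _ meagre_not_turbulent[OF ample, of n]]
    by blast
  obtain v where v: "v \<in> shift_nbhd g e" "\<forall>i<n. d (c i) (cj v (a i)) < e"
    using c(1) by (auto simp: local_orbit_def)
  have "turbulent n c" using c(1,3) by (auto simp: local_orbit_def)
  then have "linked n e' (b, h) (c, v \<otimes> g)"
    unfolding linked_def using a b v(1) U' c(2) by (auto simp: shift_nbhd_def)
  then show thesis
    using that[of c v] v c(2) by (auto simp: shift_nbhd_def B_def)
qed

text \<open>Back and forth: the two tuples are moved alternately towards each other by ever smaller group
  elements, with summable errors in \<open>d\<close>. Completeness of \<open>m\<close> makes both products of group elements
  and the tuples themselves converge, and lower semicontinuity passes the error bounds to the limit.\<close>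

theorem approximate_Effros:
  assumes ample: "ample_generics G T d" and z: "turbulent n z"
    and V: "openin T V" "\<one> \<in> V" and "\<epsilon> > 0"
  shows "\<exists>U. openin (tuples n) U \<and> z \<in> U \<and>
    (\<forall>z'. turbulent n z' \<and> z' \<in> U \<longrightarrow> z' \<in> local_orbit n V \<epsilon> z)"
proof -
  obtain r where r: "r > 0" "\<forall>x\<in>carrier G. \<forall>y\<in>carrier G. m \<one> x < r \<longrightarrow> m \<one> y < r \<longrightarrow> inv x \<otimes> y \<in> V"
    using quotient_neighbourhood[OF V] by blast
  \<comment> \<open>Each of the two products stays within \<open>2 * \<delta>\<close> of the
    identity, hence within \<open>r\<close>; each moved tuple ends within
    \<open>2 * \<delta>\<close> of the common limit, which gives
    \<open>4 * \<delta> < \<epsilon>\<close> in total.\<close>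
  define \<delta> where "\<delta> = min r \<epsilon> / 8"
  have \<delta>: "\<delta> > 0" "2 * \<delta> < r" "4 * \<delta> < \<epsilon>" using r(1) \<open>\<epsilon> > 0\<close> by (auto simp: \<delta>_def min_def)
  define e where "e j = \<delta> * (1/2) ^ j" for j :: nat
  have e0: "e j > 0" for j using \<delta>(1) by (simp add: e_def)
  have eS: "e (Suc j) = e j / 2" for j by (simp add: e_def)
  obtain U where U: "openin (tuples n) U" "z \<in> U"
    "everywhere_nonmeagre (tuples n) (local_orbit n (shift_nbhd \<one> (e 0)) (e 0) z) U"
    using z openin_shift_nbhd[OF one_closed, of "e 0"] one_in_shift_nbhd[OF one_closed e0[of 0]] e0[of 0]
    unfolding turbulent_def by meson
  have "z' \<in> local_orbit n V \<epsilon> z" if z': "turbulent n z'" "z' \<in> U" for z'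
  proof -
    \<comment> \<open>The first component of the state is moved and the second is its target;
      afterwards the target comes first and the moved tuple becomes the new target.\<close>
    define R where "R j x y \<longleftrightarrow> fst y = snd x \<and> (\<exists>v\<in>carrier G. snd (snd y) = v \<otimes> snd (fst x) \<and>
        m (snd (fst x)) (snd (snd y)) < e j \<and>
        (\<forall>i<n. d (fst (snd y) i) (cj v (fst (fst x) i)) < e j) \<and>
        (\<forall>i<n. m (fst (snd x) i) (fst (snd y) i) < e j))"
      for j and x y :: "((nat \<Rightarrow> 'a) \<times> 'a) \<times> (nat \<Rightarrow> 'a) \<times> 'a"
    have "\<exists>f. \<forall>j. (linked n (e j) (fst (f j)) (snd (f j)) \<and> (j = 0 \<longrightarrow> f j = ((z, \<one>), (z', \<one>)))) \<and>
        R j (f j) (f (Suc j))"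
    proof (rule dependent_nat_choice)
      have "linked n (e 0) (z, \<one>) (z', \<one>)"
        using z z' U by (auto simp: linked_def)
      then show "\<exists>x. linked n (e 0) (fst x) (snd x) \<and> (0 = 0 \<longrightarrow> x = ((z, \<one>), (z', \<one>)))"
        by auto
    next
      fix x j
      assume "linked n (e j) (fst x) (snd x) \<and> (j = 0 \<longrightarrow> x = ((z, \<one>), (z', \<one>)))"
      then have "linked n (e j) (fst (fst x), snd (fst x)) (fst (snd x), snd (snd x))" by simp
      from linked_step[OF ample this e0 e0[of "Suc j"]] obtain c v where cv:
        "linked n (e (Suc j)) (fst (snd x), snd (snd x)) (c, v \<otimes> snd (fst x))"
        "v \<in> carrier G" "m (snd (fst x)) (v \<otimes> snd (fst x)) < e j"
        "\<And>i. i < n \<Longrightarrow> d (c i) (cj v (fst (fst x) i)) < e j"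
        "\<And>i. i < n \<Longrightarrow> m (fst (snd x) i) (c i) < e j"
        by metis
      then show "\<exists>y. (linked n (e (Suc j)) (fst y) (snd y) \<and> (Suc j = 0 \<longrightarrow> y = ((z, \<one>), (z', \<one>)))) \<and> R j x y"
        unfolding R_def by (intro exI[of _ "(snd x, (c, v \<otimes> snd (fst x)))"]) auto
    qed
    then obtain f where f: "\<And>j. linked n (e j) (fst (f j)) (snd (f j))" "f 0 = ((z, \<one>), (z', \<one>))"
      "\<And>j. R j (f j) (f (Suc j))"
      by metis
    \<comment> \<open>The states flatten to one sequence: \<open>a (j + 2)\<close> is almost a
      conjugate of \<open>a j\<close>, with even indices issuing from \<open>z\<close> and odd ones
      from \<open>z'\<close>. The claim \<open>lim\<close> below treats both parities through its
      start index \<open>p\<close>.\<close>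
    define a where "a j = fst (fst (f j))" for j
    define g where "g j = snd (fst (f j))" for j
    have snd_f: "snd (f j) = (a (Suc j), g (Suc j))" for j
      using f(3)[of j] by (simp add: R_def a_def g_def)
    have "(z', \<one>) = (a 1, g 1)" using f(2) snd_f[of 0] by simp
    then have a01: "a 0 = z" "a 1 = z'" "g 0 = \<one>" "g 1 = \<one>"
      using f(2) by (simp_all add: a_def[of 0] g_def[of 0])
    have ta: "a j \<in> topspace (tuples n)" and gc: "g j \<in> carrier G" for j
      using f(1)[of j] turbulent_topspace by (auto simp: linked_def a_def g_def)
    have ac: "a j i \<in> carrier G" if "i < n" for i j
      by (rule topspace_tuples_nth[OF ta that])
    have step: "\<exists>v\<in>carrier G. g (Suc (Suc j)) = v \<otimes> g j \<and> m (g j) (g (Suc (Suc j))) < e j \<and>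
        (\<forall>i<n. d (a (Suc (Suc j)) i) (cj v (a j i)) < e j) \<and>
        (\<forall>i<n. m (a (Suc j) i) (a (Suc (Suc j)) i) < e j)" for j
    proof -
      have "fst (snd (f (Suc j))) = a (Suc (Suc j))" "snd (snd (f (Suc j))) = g (Suc (Suc j))"
        "fst (snd (f j)) = a (Suc j)" "fst (fst (f j)) = a j" "snd (fst (f j)) = g j"
        by (simp_all add: snd_f) (simp_all add: a_def g_def)
      then show ?thesis using f(3)[of j] unfolding R_def by simp
    qed
    have "\<exists>l. limitin T (\<lambda>j. a (Suc j) i) l sequentially" if i: "i < n" for i
    proof -
      have "m (a (Suc j) i) (a (Suc (Suc j)) i) \<le> e j" for j
        using step[of j] i by fastforce
      then have "\<exists>l\<in>carrier G. limitin m.mtopology (\<lambda>j. a (Suc j) i) l sequentially \<and>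
          (\<forall>j. m (a (Suc j) i) l \<le> 2 * e j)"
        by (intro m.geometric_sequence_converges complete_m ac i) (simp_all add: eS)
      then show ?thesis by (auto simp: T_eq)
    qed
    then obtain \<zeta> where "\<And>i. i < n \<Longrightarrow> limitin T (\<lambda>j. a (Suc j) i) (\<zeta> i) sequentially" by metis
    then have \<zeta>: "limitin T (\<lambda>j. a j i) (\<zeta> i) sequentially" if "i < n" for i
      using limitin_sequentially_offset_rev[of T "\<lambda>j. a j i" 1] that by simp
    have \<zeta>c: "\<zeta> i \<in> carrier G" if "i < n" for i
      using limitin_topspace[OF \<zeta>[OF that]] by simp
    have lim: "\<exists>u\<in>carrier G. m \<one> u \<le> 2 * \<delta> \<and> (\<forall>i<n. d (\<zeta> i) (cj u (a p i)) \<le> 2 * \<delta>)"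
      if gp: "g p = \<one>" for p
    proof -
      have "m (g (2 * j + p)) (g (2 * Suc j + p)) \<le> e (2 * j + p)" for j
        using step[of "2 * j + p"] by auto
      moreover have "e (2 * Suc j + p) \<le> e (2 * j + p) / 2" for j
        using eS[of "2 * j + p"] eS[of "Suc (2 * j + p)"] e0[of "2 * j + p"] by simp
      ultimately have "\<exists>l\<in>carrier G. limitin m.mtopology (\<lambda>j. g (2 * j + p)) l sequentially \<and>
          (\<forall>j. m (g (2 * j + p)) l \<le> 2 * e (2 * j + p))"
        by (intro m.geometric_sequence_converges complete_m gc)
      then obtain u where u: "u \<in> carrier G" "limitin T (\<lambda>j. g (2 * j + p)) u sequentially"
        "\<forall>j. m (g (2 * j + p)) u \<le> 2 * e (2 * j + p)"
        by (auto simp: T_eq)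
      have "e p \<le> \<delta>" unfolding e_def using \<delta>(1) by (simp add: power_le_one)
      then have "m \<one> u \<le> 2 * \<delta>"
        using u(3)[rule_format, of 0] gp by simp
      moreover have "d (\<zeta> i) (cj u (a p i)) \<le> 2 * \<delta>" if i: "i < n" for i
      proof -
        \<comment> \<open>The subtracted term is the error still allowed: two places further it has
          dropped to a quarter, which more than pays for the new error
          \<open>e (2 * j + p)\<close>.\<close>
        have "d (a (2 * j + p) i) (cj (g (2 * j + p)) (a p i)) \<le> 2 * \<delta> - 2 * e (2 * j + p)" for j
        proof (induction j)
          case 0
          show ?case using gp ac[OF i] \<open>e p \<le> \<delta>\<close> by simp
        next
          case (Suc j)
          obtain v where v: "v \<in> carrier G" "g (Suc (Suc (2 * j + p))) = v \<otimes> g (2 * j + p)"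
            "d (a (Suc (Suc (2 * j + p))) i) (cj v (a (2 * j + p) i)) < e (2 * j + p)"
            using step[of "2 * j + p"] i by auto
          have "d (a (Suc (Suc (2 * j + p))) i) (cj (g (Suc (Suc (2 * j + p)))) (a p i))
            \<le> d (a (Suc (Suc (2 * j + p))) i) (cj v (a (2 * j + p) i))
              + d (cj v (a (2 * j + p) i)) (cj (v \<otimes> g (2 * j + p)) (a p i))"
            unfolding v(2) using v(1) ac[OF i] gc by (intro d.triangle) auto
          also have "d (cj v (a (2 * j + p) i)) (cj (v \<otimes> g (2 * j + p)) (a p i))
            = d (a (2 * j + p) i) (cj (g (2 * j + p)) (a p i))"
            using v(1) ac[OF i] gc by (simp add: cj_mult)
          finally show ?case
            using Suc v(3) e0[of "2 * j + p"] eS[of "2 * j + p"] eS[of "Suc (2 * j + p)"] by simp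
        qed
        then have bd: "d (a (2 * j + p) i) (cj (g (2 * j + p)) (a p i)) \<le> 2 * \<delta>" for j
          using e0[of "2 * j + p"] by (smt (verit))
        have "strict_mono (\<lambda>j. 2 * j + p)" by (simp add: strict_mono_def)
        from limitin_subsequence[OF this \<zeta>[OF i]]
        have "limitin T (\<lambda>j. a (2 * j + p) i) (\<zeta> i) sequentially" by (simp add: o_def)
        then show ?thesis
          by (rule d_limit_le[OF _ limitin_cj[OF u(2) ac[OF i]] bd]) (use ac[OF i] gc in auto)
      qed
      ultimately show ?thesis using u(1) by blast
    qed
    obtain u where u: "u \<in> carrier G" "m \<one> u \<le> 2 * \<delta>" "\<forall>i<n. d (\<zeta> i) (cj u (z i)) \<le> 2 * \<delta>"
      using lim[of 0] a01 by auto
    obtain w where w: "w \<in> carrier G" "m \<one> w \<le> 2 * \<delta>" "\<forall>i<n. d (\<zeta> i) (cj w (z' i)) \<le> 2 * \<delta>"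
      using lim[of 1] a01 by auto
    \<comment> \<open>\<open>u\<close> brings \<open>z\<close>, and \<open>w\<close> brings
      \<open>z'\<close>, close to the same limit, so \<open>inv w \<otimes> u\<close> brings
      \<open>z\<close> close to \<open>z'\<close>.\<close>
    have "inv w \<otimes> u \<in> V" using r(2) u w \<delta>(2) by simp
    moreover have "d (z' i) (cj (inv w \<otimes> u) (z i)) < \<epsilon>" if i: "i < n" for i
    proof -
      have c: "z i \<in> carrier G" "z' i \<in> carrier G" using ac[OF i] a01 by metis+
      have "d (z' i) (cj (inv w \<otimes> u) (z i)) = d (cj u (z i)) (cj w (z' i))"
        using d_cj_inv_left[OF w(1) u(1) c] d.commute by simp
      also have "\<dots> \<le> d (cj u (z i)) (\<zeta> i) + d (\<zeta> i) (cj w (z' i))"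
        using c u(1) w(1) \<zeta>c[OF i] by (intro d.triangle) auto
      also have "\<dots> \<le> 4 * \<delta>"
        using u(3) w(3) i by (fastforce simp: d.commute)
      finally show ?thesis using \<delta>(3) by simp
    qed
    ultimately show ?thesis
      using turbulent_topspace[OF z'(1)] by (auto simp: local_orbit_def)
  qed
  then show ?thesis using U by blast
qed

section \<open>Generic sequences\<close>

text \<open>Turbulence is not inherited by extensions of a tuple, so the quantifier ``for almost all \<open>y\<close>''
  is iterated before passing to the intersection over all \<open>k\<close>.\<close>

primrec hereditarily_turbulent :: "nat \<Rightarrow> nat \<Rightarrow> (nat \<Rightarrow> 'a) \<Rightarrow> bool" where
  "hereditarily_turbulent 0 n z \<longleftrightarrow> turbulent n z"
| "hereditarily_turbulent (Suc k) n z \<longleftrightarrow> hereditarily_turbulent k n z \<and>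
    meagre_in T {y \<in> carrier G. \<not> hereditarily_turbulent k (Suc n) (z(n := y))}"

definition generic :: "nat \<Rightarrow> (nat \<Rightarrow> 'a) \<Rightarrow> bool" where
  "generic n z \<longleftrightarrow> (\<forall>k. hereditarily_turbulent k n z)"

lemma generic_turbulent: "generic n z \<Longrightarrow> turbulent n z"
  unfolding generic_def using hereditarily_turbulent.simps(1) by blast

lemma meagre_not_generic_extension:
  assumes "generic n z"
  shows "meagre_in T {y \<in> carrier G. \<not> generic (Suc n) (z(n := y))}"
proof -
  have "meagre_in T {y \<in> carrier G. \<not> hereditarily_turbulent k (Suc n) (z(n := y))}" for k
    using assms unfolding generic_def using hereditarily_turbulent.simps(2) by blast
  then have "meagre_in T (\<Union>k. {y \<in> carrier G. \<not> hereditarily_turbulent k (Suc n) (z(n := y))})"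
    by (intro meagre_in_UN) auto
  then show ?thesis
    by (elim meagre_in_subset) (auto simp: generic_def)
qed

text \<open>By Kuratowski-Ulam, failure on a meagre set of tuples of length \<open>Suc n\<close>
  means failure on meagre sections over almost every tuple of length \<open>n\<close>, which is the
  clause added at stage \<open>Suc k\<close>. The induction therefore needs all lengths at
  once.\<close>

lemma meagre_not_hereditarily_turbulent:
  assumes ample: "ample_generics G T d"
  shows "meagre_in (tuples n) {z \<in> topspace (tuples n). \<not> hereditarily_turbulent k n z}"
proof (induction k arbitrary: n)
  case 0
  show ?case using meagre_not_turbulent[OF ample] by simp
next
  case (Suc k)
  let ?M = "{z \<in> topspace (tuples (Suc n)). \<not> hereditarily_turbulent k (Suc n) z}"
  let ?N = "{z \<in> topspace (tuples n). \<not> meagre_in T {y \<in> topspace T. z(n := y) \<in> ?M}}"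
  have *: "meagre_in (tuples n) ({z \<in> topspace (tuples n). \<not> hereditarily_turbulent k n z} \<union> ?N)"
    by (intro meagre_in_Un Suc meagre_in_power_Suc_sections second_countable_T)
  show ?case
  proof (rule meagre_in_subset[OF *], intro subsetI)
    fix z assume "z \<in> {z \<in> topspace (tuples n). \<not> hereditarily_turbulent (Suc k) n z}"
    then have z: "z \<in> topspace (tuples n)" "\<not> hereditarily_turbulent (Suc k) n z" by simp_all
    have "{y \<in> topspace T. z(n := y) \<in> ?M} = {y \<in> carrier G. \<not> hereditarily_turbulent k (Suc n) (z(n := y))}"
      using fun_upd_in_topspace_power[OF z(1)] by auto
    then show "z \<in> {z \<in> topspace (tuples n). \<not> hereditarily_turbulent k n z} \<union> ?N"
      using z by auto
  qed
qed

text \<open>The space of empty tuples is a single point, so what holds off a meagre set holds at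
  that point. This starts the Cantor scheme.\<close>

lemma generic_empty_tuple_exists:
  assumes "ample_generics G T d"
  shows "\<exists>z. generic 0 z"
proof -
  have "meagre_in (tuples 0) (\<Union>k. {z \<in> topspace (tuples 0). \<not> hereditarily_turbulent k 0 z})"
    by (intro meagre_in_UN meagre_not_hereditarily_turbulent assms) auto
  moreover have "\<not> meagre_in (tuples 0) (topspace (tuples 0))"
    by (rule not_meagre_tuples[OF openin_topspace]) (simp add: topspace_power_topology)
  ultimately have "\<not> topspace (tuples 0) \<subseteq> (\<Union>k. {z \<in> topspace (tuples 0). \<not> hereditarily_turbulent k 0 z})"
    using meagre_in_subset by blast
  then show ?thesis by (auto simp: generic_def)
qed

text \<open>First \<open>y\<close> is taken in \<open>A\<close>. The approximate Effros theorem at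
  \<open>x(n := y)\<close> gives a neighbourhood in whose slice over \<open>x\<close> the set
  \<open>B\<close> is non-meagre, which yields \<open>y'\<close>. Some small \<open>v\<close> takes
  \<open>x(n := y)\<close> close to \<open>x(n := y')\<close>; as the first \<open>n\<close> entries
  agree, its inverse almost fixes them and takes \<open>y'\<close> close to
  \<open>y\<close>.\<close>

lemma generic_extension_pair:
  assumes ample: "ample_generics G T d" and x: "generic n x"
    and A: "\<not> meagre_in T A" "A \<subseteq> carrier G" and B: "everywhere_nonmeagre T B (carrier G)"
    and h: "h \<in> carrier G" and "\<delta> > 0"
  shows "\<exists>f y y'. f \<in> carrier G \<and> y \<in> A \<and> y' \<in> B \<and> y' \<in> carrier G \<and> m h (h \<otimes> f) < \<delta> \<and>
    generic (Suc n) (x(n := y)) \<and> generic (Suc n) (x(n := y')) \<and>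
    (\<forall>i<n. d (cj f (x i)) (x i) < \<delta>) \<and> d (cj f y') y < \<delta>"
proof -
  let ?bad = "{y \<in> carrier G. \<not> generic (Suc n) (x(n := y))}"
  have bad: "meagre_in T ?bad" by (rule meagre_not_generic_extension[OF x])
  have xt: "x \<in> topspace (tuples n)"
    using generic_turbulent[OF x] turbulent_topspace by blast
  obtain y where y: "y \<in> A" "y \<notin> ?bad"
    using A(1) meagre_in_subset[OF bad] by blast
  have yc: "y \<in> carrier G" and yg: "generic (Suc n) (x(n := y))" using y A(2) by auto
  \<comment> \<open>The condition is on \<open>h \<otimes> inv v\<close> because the factor finally
    used is the inverse of the element supplied by the Effros theorem.\<close>
  define V where "V = {v \<in> topspace T. h \<otimes> inv v \<in> {y \<in> carrier G. m h y < \<delta>}}"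
  have "continuous_map T T (\<lambda>v. h \<otimes> inv v)"
    by (rule continuous_map_mult) (use h continuous_map_inversion in auto)
  from openin_continuous_map_preimage[OF this openin_T_ball[OF h]]
  have V: "openin T V" unfolding V_def .
  have V1: "\<one> \<in> V" using h \<open>\<delta> > 0\<close> by (simp add: V_def)
  obtain U where U: "openin (tuples (Suc n)) U" "x(n := y) \<in> U"
    "\<forall>z'. turbulent (Suc n) z' \<and> z' \<in> U \<longrightarrow> z' \<in> local_orbit (Suc n) V \<delta> (x(n := y))"
    using approximate_Effros[OF ample generic_turbulent[OF yg] V V1 \<open>\<delta> > 0\<close>] by metis
  have "continuous_map T (prod_topology (tuples n) T) (\<lambda>b. (x, b))"
    using xt by (simp add: continuous_map_pairedI)
  from continuous_map_compose[OF this
      homeomorphic_imp_continuous_map[OF homeomorphic_maps_imp_map[OF homeomorphic_maps_power_Suc]]]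
  have "continuous_map T (tuples (Suc n)) (\<lambda>b. x(n := b))" by (simp add: o_def)
  from openin_continuous_map_preimage[OF this U(1)]
  have o: "openin T {b \<in> carrier G. x(n := b) \<in> U}" by simp
  obtain y' where y': "y' \<in> B" "y' \<in> {b \<in> carrier G. x(n := b) \<in> U}" "y' \<notin> ?bad"
    by (rule everywhere_nonmeagre_meets[OF B o _ _ bad]) (use U(2) yc in auto)
  then have y'g: "generic (Suc n) (x(n := y'))" by simp
  then obtain v where v: "v \<in> V" "\<forall>i<Suc n. d ((x(n := y')) i) (cj v ((x(n := y)) i)) < \<delta>"
    using U(3) generic_turbulent y'(2) unfolding local_orbit_def by blast
  have vc: "v \<in> carrier G" using v(1) by (simp add: V_def)
  have flip: "d (cj (inv v) b) c = d b (cj v c)" if "b \<in> carrier G" "c \<in> carrier G" for b c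
    using d_cj_inv_left[OF vc one_closed that] vc that by simp
  have "d (cj (inv v) (x i)) (x i) < \<delta>" if i: "i < n" for i
    using v(2)[rule_format, of i] i flip topspace_tuples_nth[OF xt i] by simp
  moreover have "d (cj (inv v) y') y < \<delta>"
    using v(2)[rule_format, of n] flip y' yc by simp
  moreover have "m h (h \<otimes> inv v) < \<delta>" using v(1) by (simp add: V_def)
  ultimately show ?thesis using vc y(1) y'(1,2) yg y'g by (intro exI[of _ "inv v"] exI[of _ y] exI[of _ y']) auto
qed

end

section \<open>A Cantor scheme of conjugating elements\<close>

primrec branch :: "(nat \<Rightarrow> 's \<Rightarrow> bool \<Rightarrow> 's) \<Rightarrow> 's \<Rightarrow> (nat \<Rightarrow> bool) \<Rightarrow> nat \<Rightarrow> 's" where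
  "branch F s \<alpha> 0 = s"
| "branch F s \<alpha> (Suc n) = F n (branch F s \<alpha> n) (\<alpha> n)"

lemma branch_cong: "(\<And>i. i < n \<Longrightarrow> \<alpha> i = \<beta> i) \<Longrightarrow> branch F s \<alpha> n = branch F s \<beta> n"
  by (induction n) auto

context metrized_topometric_group
begin

text \<open>Along a branch, \<open>g \<alpha> (n + 1)\<close> is \<open>g \<alpha> n\<close> or \<open>g \<alpha> n \<otimes> f\<close>, where \<open>f\<close> almost fixes (in \<open>d\<close>) all
  elements chosen so far and moves the newly chosen element of \<open>B\<close> close to the one of \<open>A\<close>. Later
  factors therefore do not destroy the coincidence created at level \<open>n\<close>.\<close>

theorem conjugating_Cantor_scheme:
  assumes ample: "ample_generics G T d"
    and A: "\<not> meagre_in T A" "A \<subseteq> carrier G" and B: "everywhere_nonmeagre T B (carrier G)"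
    and "\<epsilon> > 0"
  obtains h :: "(nat \<Rightarrow> bool) \<Rightarrow> 'a"
  where "\<And>\<alpha>. h \<alpha> \<in> carrier G"
    and "\<And>\<alpha> \<beta> n. (\<And>i. i < n \<Longrightarrow> \<alpha> i = \<beta> i) \<Longrightarrow> \<not> \<alpha> n \<Longrightarrow> \<beta> n \<Longrightarrow>
      \<exists>x\<in>A. \<exists>y\<in>B \<inter> carrier G. d (cj (h \<alpha>) x) (cj (h \<beta>) y) < \<epsilon>"
proof -
  \<comment> \<open>The final distance has three parts, each at most
    \<open>e n \<le> \<epsilon> / 3\<close>: the coincidence made at level \<open>n\<close> and the
    later drift along either branch.\<close>
  define e where "e j = \<epsilon> / 3 * (1/2) ^ j" for j :: nat
  have e0: "e j > 0" for j using \<open>\<epsilon> > 0\<close> by (simp add: e_def)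
  have eS: "e (Suc j) = e j / 2" for j by (simp add: e_def)
  have ele: "e j \<le> \<epsilon> / 3" for j
    using \<open>\<epsilon> > 0\<close> by (simp add: e_def power_le_one)
  define good where "good n h x t \<longleftrightarrow> fst t \<in> carrier G \<and> fst (snd t) \<in> A \<and> snd (snd t) \<in> B \<and>
      snd (snd t) \<in> carrier G \<and> m h (h \<otimes> fst t) < e n \<and>
      generic (Suc n) (x(n := fst (snd t))) \<and> generic (Suc n) (x(n := snd (snd t))) \<and>
      (\<forall>i<n. d (cj (fst t) (x i)) (x i) < e n) \<and> d (cj (fst t) (snd (snd t))) (fst (snd t)) < e n"
    for n h x and t :: "'a \<times> 'a \<times> 'a"
  \<comment> \<open>One choice function of level and state: branches that agree below
    \<open>n\<close> then use the same factor and the same pair of elements at level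
    \<open>n\<close>.\<close>
  define t where "t n h x = (SOME t. good n h x t)" for n h x
  have t: "good n h x (t n h x)" if nx: "generic n x" and hc: "h \<in> carrier G" for n h x
  proof -
    obtain f y y' where "good n h x (f, y, y')"
      using generic_extension_pair[OF ample nx A B hc e0[of n]] unfolding good_def by auto
    then show ?thesis unfolding t_def by (rule someI)
  qed
  define F where "F n s b = (if b then (fst s \<otimes> fst (t n (fst s) (snd s)), (snd s)(n := snd (snd (t n (fst s) (snd s)))))
      else (fst s, (snd s)(n := fst (snd (t n (fst s) (snd s))))))"
    for n b and s :: "'a \<times> (nat \<Rightarrow> 'a)"
  obtain x0 where x0: "generic 0 x0" using generic_empty_tuple_exists[OF ample] by blast
  define st where "st \<alpha> n = branch F (\<one>, x0) \<alpha> n" for \<alpha> n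
  define g where "g \<alpha> n = fst (st \<alpha> n)" for \<alpha> n
  define x where "x \<alpha> n = snd (st \<alpha> n)" for \<alpha> n
  define tt where "tt \<alpha> n = t n (g \<alpha> n) (x \<alpha> n)" for \<alpha> n
  have g0: "g \<alpha> 0 = \<one>" and x0': "x \<alpha> 0 = x0" for \<alpha>
    by (simp_all add: g_def x_def st_def)
  have gS: "g \<alpha> (Suc n) = (if \<alpha> n then g \<alpha> n \<otimes> fst (tt \<alpha> n) else g \<alpha> n)" for \<alpha> n
    by (simp add: g_def x_def st_def F_def tt_def)
  have xS: "x \<alpha> (Suc n) = (x \<alpha> n)(n := if \<alpha> n then snd (snd (tt \<alpha> n)) else fst (snd (tt \<alpha> n)))" for \<alpha> n
    by (simp add: g_def x_def st_def F_def tt_def)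
  have inv: "generic n (x \<alpha> n) \<and> g \<alpha> n \<in> carrier G" for \<alpha> n
  proof (induction n)
    case 0
    show ?case using x0 by (simp add: g0 x0')
  next
    case (Suc n)
    then have gd: "good n (g \<alpha> n) (x \<alpha> n) (tt \<alpha> n)" using t by (simp add: tt_def)
    then have "generic (Suc n) (x \<alpha> (Suc n))"
      unfolding xS good_def by (cases "\<alpha> n") (simp_all only: if_True if_False)
    then show ?case using Suc gd by (simp add: good_def gS)
  qed
  have gc: "g \<alpha> n \<in> carrier G" for \<alpha> n using inv by blast
  have tt: "good n (g \<alpha> n) (x \<alpha> n) (tt \<alpha> n)" for \<alpha> n
    using t inv by (simp add: tt_def)
  have xc: "x \<alpha> n i \<in> carrier G" if "i < n" for \<alpha> n i
    using inv[of n \<alpha>] topspace_tuples_nth[OF turbulent_topspace[OF generic_turbulent]] that by blast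
  define y where "y \<alpha> n = x \<alpha> (Suc n) n" for \<alpha> n
  have yc: "y \<alpha> n \<in> carrier G" for \<alpha> n by (simp add: y_def xc)
  have xy: "x \<alpha> (Suc n + k) n = y \<alpha> n" for \<alpha> n k
  proof (induction k)
    case (Suc k)
    then show ?case by (simp add: xS[of \<alpha> "Suc (n + k)"])
  qed (simp add: y_def)
  have mstep: "m (g \<alpha> n) (g \<alpha> (Suc n)) \<le> e n" for \<alpha> n
    using tt[of n \<alpha>] e0[of n] gc[of \<alpha> n] by (auto simp: gS good_def)
  have "\<exists>l\<in>carrier G. limitin m.mtopology (g \<alpha>) l sequentially \<and> (\<forall>n. m (g \<alpha> n) l \<le> 2 * e n)" for \<alpha>
    by (intro m.geometric_sequence_converges complete_m gc mstep) (simp add: eS)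
  then obtain h where h: "\<And>\<alpha>. h \<alpha> \<in> carrier G" "\<And>\<alpha>. limitin T (g \<alpha>) (h \<alpha>) sequentially"
    unfolding T_eq by metis
  have dstep: "d (cj (g \<alpha> (Suc n)) (x \<alpha> n i)) (cj (g \<alpha> n) (x \<alpha> n i)) \<le> e n" if i: "i < n" for \<alpha> n i
  proof (cases "\<alpha> n")
    case True
    have f: "fst (tt \<alpha> n) \<in> carrier G" "d (cj (fst (tt \<alpha> n)) (x \<alpha> n i)) (x \<alpha> n i) < e n"
      using tt[of n \<alpha>] i by (auto simp: good_def)
    then show ?thesis using True gc[of \<alpha> n] xc[OF i] by (simp add: gS cj_mult)
  next
    case False
    then show ?thesis using e0[of n] gc[of \<alpha> n] xc[OF i] by (simp add: gS)
  qed
  have near: "d (cj (h \<alpha>) (y \<alpha> n)) (cj (g \<alpha> (Suc n)) (y \<alpha> n)) \<le> e n" for \<alpha> n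
  proof -
    \<comment> \<open>The bound starts at 0 because \<open>2 * e (Suc n) = e n\<close>. Later
      factors almost fix the recorded element \<open>y \<alpha> n\<close>, with errors
      \<open>e (Suc n)\<close>, \<open>e (Suc (Suc n))\<close>, ... whose sum is at most
      \<open>e n\<close>.\<close>
    have "d (cj (g \<alpha> (Suc n + k)) (y \<alpha> n)) (cj (g \<alpha> (Suc n)) (y \<alpha> n)) \<le> e n - 2 * e (Suc n + k)" for k
    proof (induction k)
      case 0
      show ?case using yc gc by (simp add: eS)
    next
      case (Suc k)
      have "d (cj (g \<alpha> (Suc n + Suc k)) (y \<alpha> n)) (cj (g \<alpha> (Suc n)) (y \<alpha> n))
        \<le> d (cj (g \<alpha> (Suc n + Suc k)) (y \<alpha> n)) (cj (g \<alpha> (Suc n + k)) (y \<alpha> n))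
          + d (cj (g \<alpha> (Suc n + k)) (y \<alpha> n)) (cj (g \<alpha> (Suc n)) (y \<alpha> n))"
        using yc gc by (intro d.triangle) auto
      moreover have "d (cj (g \<alpha> (Suc n + Suc k)) (y \<alpha> n)) (cj (g \<alpha> (Suc n + k)) (y \<alpha> n)) \<le> e (Suc n + k)"
        using dstep[of n "Suc n + k" \<alpha>] xy by simp
      ultimately show ?case using Suc eS[of "Suc n + k"] by simp
    qed
    then have bd: "d (cj (g \<alpha> (k + Suc n)) (y \<alpha> n)) (cj (g \<alpha> (Suc n)) (y \<alpha> n)) \<le> e n" for k
      using e0[of "Suc n + k"] by (smt (verit) add.commute)
    have "limitin T (\<lambda>k. g \<alpha> (k + Suc n)) (h \<alpha>) sequentially"
      by (rule limitin_sequentially_offset[OF h(2)])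
    from d_limit_le[OF limitin_cj[OF this yc] _ bd] show ?thesis
      using yc gc by simp
  qed
  show thesis
  proof (rule that[of h])
    fix \<alpha> \<beta> :: "nat \<Rightarrow> bool" and n
    assume eq: "\<And>i. i < n \<Longrightarrow> \<alpha> i = \<beta> i" and n: "\<not> \<alpha> n" "\<beta> n"
    have st: "st \<alpha> n = st \<beta> n" unfolding st_def by (rule branch_cong[OF eq])
    have same: "g \<alpha> n = g \<beta> n" "tt \<alpha> n = tt \<beta> n" using st by (simp_all add: g_def x_def tt_def)
    have gd: "fst (tt \<beta> n) \<in> carrier G" "fst (snd (tt \<beta> n)) \<in> A" "snd (snd (tt \<beta> n)) \<in> B"
      "d (cj (fst (tt \<beta> n)) (snd (snd (tt \<beta> n)))) (fst (snd (tt \<beta> n))) < e n"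
      using tt[of n \<beta>] by (auto simp: good_def)
    have y: "y \<alpha> n = fst (snd (tt \<beta> n))" "y \<beta> n = snd (snd (tt \<beta> n))"
      using n by (simp_all add: y_def xS same)
    have g: "g \<alpha> (Suc n) = g \<beta> n" "g \<beta> (Suc n) = g \<beta> n \<otimes> fst (tt \<beta> n)"
      using n by (simp_all add: gS same)
    \<comment> \<open>Both points are conjugates by the common \<open>g \<beta> n\<close>: on one
      side of the chosen element of \<open>A\<close>, on the other of the element of
      \<open>B\<close> already moved next to it by the factor.\<close>
    have "d (cj (g \<alpha> (Suc n)) (y \<alpha> n)) (cj (g \<beta> (Suc n)) (y \<beta> n)) < e n"
      using gd(1,4) yc[of \<alpha> n] yc[of \<beta> n] gc[of \<beta> n] unfolding g y
      by (simp add: cj_mult d.commute)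
    moreover have "d (cj (h \<alpha>) (y \<alpha> n)) (cj (h \<beta>) (y \<beta> n))
      \<le> d (cj (h \<alpha>) (y \<alpha> n)) (cj (g \<alpha> (Suc n)) (y \<alpha> n))
        + (d (cj (g \<alpha> (Suc n)) (y \<alpha> n)) (cj (g \<beta> (Suc n)) (y \<beta> n))
          + d (cj (g \<beta> (Suc n)) (y \<beta> n)) (cj (h \<beta>) (y \<beta> n)))"
      using d.triangle[of "cj (h \<alpha>) (y \<alpha> n)" "cj (g \<alpha> (Suc n)) (y \<alpha> n)" "cj (h \<beta>) (y \<beta> n)"]
        d.triangle[of "cj (g \<alpha> (Suc n)) (y \<alpha> n)" "cj (g \<beta> (Suc n)) (y \<beta> n)" "cj (h \<beta>) (y \<beta> n)"]
        h(1) gc yc by simp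
    ultimately have "d (cj (h \<alpha>) (y \<alpha> n)) (cj (h \<beta>) (y \<beta> n)) < \<epsilon>"
      using near[of \<alpha> n] near[of \<beta> n] ele[of n]
        d.commute[of "cj (g \<beta> (Suc n)) (y \<beta> n)" "cj (h \<beta>) (y \<beta> n)"] by linarith
    then show "\<exists>x\<in>A. \<exists>y\<in>B \<inter> carrier G. d (cj (h \<alpha>) x) (cj (h \<beta>) y) < \<epsilon>"
      using gd(2,3) y yc[of \<beta> n] by (intro bexI[of _ "y \<alpha> n"] bexI[of _ "y \<beta> n"]) auto
  qed (rule h(1))
qed

end

section \<open>Automatic continuity\<close>

lemma (in Metric_space) separable_imp_second_countable:
  assumes "separable_space mtopology"
  shows "second_countable mtopology"
proof -
  obtain Q where Q: "countable Q" "Q \<subseteq> M" "mtopology closure_of Q = M"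
    using assms by (auto simp: separable_space_def)
  show ?thesis
    unfolding second_countable_def
  proof (intro exI[of _ "(\<lambda>(c, n :: nat). mball c (1 / (real n + 1))) ` (Q \<times> UNIV)"] conjI allI impI)
    fix U x assume U: "openin mtopology U \<and> x \<in> U"
    then obtain r where r: "r > 0" "mball x r \<subseteq> U" by (auto simp: openin_mtopology)
    have xM: "x \<in> M" using U openin_subset[of mtopology U] by auto
    obtain n where n: "1 / (real n + 1) < r / 2"
      using reals_Archimedean[of "r / 2"] r(1) by (auto simp: inverse_eq_divide add.commute)
    have "\<forall>U. x \<in> U \<and> openin mtopology U \<longrightarrow> (\<exists>y. y \<in> Q \<and> y \<in> U)"
      using Q(3) xM in_closure_of[of x mtopology Q] by simp
    from this[rule_format, of "mball x (1 / (real n + 1))"]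
    obtain c where c: "c \<in> Q" "c \<in> mball x (1 / (real n + 1))"
      using xM by (auto simp: openin_mball)
    have "mball c (1 / (real n + 1)) \<subseteq> mball x r"
    proof
      fix y assume y: "y \<in> mball c (1 / (real n + 1))"
      have "d x y \<le> d x c + d c y" using y c xM by (intro triangle) auto
      then show "y \<in> mball x r" using y c(2) n xM by auto
    qed
    moreover have "x \<in> mball c (1 / (real n + 1))" using c(2) by (auto simp: commute)
    ultimately show "\<exists>V\<in>(\<lambda>(c, n :: nat). mball c (1 / (real n + 1))) ` (Q \<times> UNIV). x \<in> V \<and> V \<subseteq> U"
      using c(1) r(2) by (intro bexI[of _ "mball c (1 / (real n + 1))"]) auto
  qed (use Q(1) in auto)
qed

section \<open>Neighbourhoods and translates in the target group\<close>

lemma symmetric_square_root_neighbourhood: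
  assumes "topological_group H TH" "openin TH V" "\<one>\<^bsub>H\<^esub> \<in> V"
  shows "\<exists>W. openin TH W \<and> \<one>\<^bsub>H\<^esub> \<in> W \<and> (\<forall>x\<in>W. inv\<^bsub>H\<^esub> x \<in> W) \<and> (\<forall>x\<in>W. \<forall>y\<in>W. x \<otimes>\<^bsub>H\<^esub> y \<in> V)"
proof -
  interpret H: group H using assms(1) by (simp add: topological_group_def)
  have top: "topspace TH = carrier H"
    and mult: "continuous_map (prod_topology TH TH) TH (\<lambda>(x, y). x \<otimes>\<^bsub>H\<^esub> y)"
    and inver: "continuous_map TH TH (\<lambda>x. inv\<^bsub>H\<^esub> x)"
    using assms(1) by (simp_all add: topological_group_def)
  let ?P = "{z \<in> topspace (prod_topology TH TH). (\<lambda>(x, y). x \<otimes>\<^bsub>H\<^esub> y) z \<in> V}"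
  have "openin (prod_topology TH TH) ?P"
    by (rule openin_continuous_map_preimage[OF mult assms(2)])
  moreover have "(\<one>\<^bsub>H\<^esub>, \<one>\<^bsub>H\<^esub>) \<in> ?P" using assms(3) by (simp add: top)
  ultimately obtain A B where AB: "openin TH A" "openin TH B" "\<one>\<^bsub>H\<^esub> \<in> A" "\<one>\<^bsub>H\<^esub> \<in> B" "A \<times> B \<subseteq> ?P"
    unfolding openin_prod_topology_alt by meson
  define W where "W = A \<inter> B \<inter> {x \<in> topspace TH. inv\<^bsub>H\<^esub> x \<in> A \<inter> B}"
  have Wc: "x \<in> carrier H" if "x \<in> W" for x using that by (simp add: W_def top)
  have "openin TH W"
    unfolding W_def by (intro openin_Int openin_continuous_map_preimage[OF inver] AB(1,2))
  moreover have "\<one>\<^bsub>H\<^esub> \<in> W" using AB(3,4) by (simp add: W_def top)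
  moreover have "\<forall>x\<in>W. inv\<^bsub>H\<^esub> x \<in> W" using Wc by (auto simp: W_def top)
  moreover have "x \<otimes>\<^bsub>H\<^esub> y \<in> V" if "x \<in> W" "y \<in> W" for x y
  proof -
    have "(x, y) \<in> A \<times> B" using that by (simp add: W_def)
    then show ?thesis using AB(5) by auto
  qed
  ultimately show ?thesis by blast
qed

text \<open>An injective assignment of translates would embed the reals into \<open>S\<close>. So
  two elements share a translate, and the common left factor cancels in their quotient.\<close>

lemma small_translate_cover_pigeonhole:
  fixes f :: "(nat \<Rightarrow> bool) \<Rightarrow> 'c"
  assumes "group H" "V \<subseteq> carrier H" and f: "\<And>\<alpha>. f \<alpha> \<in> carrier H"
    and S: "S \<subseteq> carrier H" "|S| <o |UNIV :: real set|" "carrier H \<subseteq> (\<Union>s\<in>S. s <#\<^bsub>H\<^esub> V)"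
  obtains \<alpha> \<beta> v w where "\<alpha> \<noteq> \<beta>" "v \<in> V" "w \<in> V" "inv\<^bsub>H\<^esub> (f \<alpha>) \<otimes>\<^bsub>H\<^esub> f \<beta> = inv\<^bsub>H\<^esub> v \<otimes>\<^bsub>H\<^esub> w"
proof -
  interpret H: group H by fact
  have "\<exists>s\<in>S. \<exists>v\<in>V. f \<alpha> = s \<otimes>\<^bsub>H\<^esub> v" for \<alpha>
    using f[of \<alpha>] S(3) unfolding l_coset_def by blast
  then obtain s v where sv: "\<And>\<alpha>. s \<alpha> \<in> S" "\<And>\<alpha>. v \<alpha> \<in> V" "\<And>\<alpha>. f \<alpha> = s \<alpha> \<otimes>\<^bsub>H\<^esub> v \<alpha>"
    by metis
  have "\<not> inj s"
  proof
    assume "inj s"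
    moreover have "inj (\<lambda>X i. (i :: nat) \<in> X)" by (auto simp: inj_on_def fun_eq_iff)
    ultimately have "inj (s \<circ> (\<lambda>X i. i \<in> X))" by (rule inj_compose)
    then have "(UNIV :: nat set set) \<lesssim> S"
      unfolding lepoll_def using sv(1) by (intro exI[of _ "s \<circ> (\<lambda>X i. i \<in> X)"]) auto
    then have "(UNIV :: real set) \<lesssim> S"
      using nat_sets_eqpoll_reals eqpoll_imp_lepoll eqpoll_sym lepoll_trans by blast
    then have "|UNIV :: real set| \<le>o |S|"
      using card_of_ordLeq unfolding lepoll_def by blast
    then show False using S(2) not_ordLess_ordLeq by blast
  qed
  then obtain \<alpha> \<beta> where ab: "\<alpha> \<noteq> \<beta>" "s \<alpha> = s \<beta>" by (auto simp: inj_on_def)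
  have c: "s \<beta> \<in> carrier H" "v \<alpha> \<in> carrier H" "v \<beta> \<in> carrier H"
    using sv S(1) assms(2) by auto
  have "inv\<^bsub>H\<^esub> (f \<alpha>) \<otimes>\<^bsub>H\<^esub> f \<beta> = inv\<^bsub>H\<^esub> (v \<alpha>) \<otimes>\<^bsub>H\<^esub> (inv\<^bsub>H\<^esub> (s \<beta>) \<otimes>\<^bsub>H\<^esub> (s \<beta> \<otimes>\<^bsub>H\<^esub> v \<beta>))"
    using c by (simp add: sv(3) ab(2) H.inv_mult_group H.m_assoc)
  also have "\<dots> = inv\<^bsub>H\<^esub> (v \<alpha>) \<otimes>\<^bsub>H\<^esub> v \<beta>"
    using c by (simp add: H.m_assoc[symmetric])
  finally show thesis using that[OF ab(1) sv(2) sv(2)] by blast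
qed

section \<open>Continuity at the identity\<close>

context metrized_topometric_group
begin

lemma homomorphism_continuous_at_one:
  fixes H :: "('c, 'e) monoid_scheme"
  assumes ample: "ample_generics G T d" and H: "topological_group H TH"
    and souslin: "uniform_souslin_lt_continuum H TH"
    and hom: "\<phi> \<in> hom G H" and cont: "continuous_map d.mtopology TH \<phi>"
    and U: "openin TH U" "\<one>\<^bsub>H\<^esub> \<in> U"
  shows "\<exists>N. openin T N \<and> \<one> \<in> N \<and> \<phi> ` N \<subseteq> U"
proof -
  interpret \<phi>: group_hom G H \<phi>
    using H hom by (simp add: topological_group_def group_hom_def group_hom_axioms_def group_axioms)
  have top: "topspace TH = carrier H" using H by (simp add: topological_group_def)
  \<comment> \<open>Products of two elements of \<open>V (Suc n)\<close> lie in \<open>V n\<close>.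
    Level 5 is used for the cover, so colliding quotients lie at level 4; conjugating one level 4
    element by another leads to level 2; a \<open>d\<close>-small correction of level 2 leads to
    level 1; the Pettis quotient leads to level 0, inside \<open>U\<close>.\<close>
  have "\<exists>V. \<forall>n. (openin TH (V n) \<and> \<one>\<^bsub>H\<^esub> \<in> V n \<and> (\<forall>x\<in>V n. inv\<^bsub>H\<^esub> x \<in> V n) \<and> (n = 0 \<longrightarrow> V n \<subseteq> U)) \<and>
      (\<forall>x\<in>V (Suc n). \<forall>y\<in>V (Suc n). x \<otimes>\<^bsub>H\<^esub> y \<in> V n)"
  proof (rule dependent_nat_choice)
    obtain W where W: "openin TH W" "\<one>\<^bsub>H\<^esub> \<in> W" "\<forall>x\<in>W. inv\<^bsub>H\<^esub> x \<in> W" "\<forall>x\<in>W. \<forall>y\<in>W. x \<otimes>\<^bsub>H\<^esub> y \<in> U"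
      using symmetric_square_root_neighbourhood[OF H U] by metis
    have "x \<in> U" if "x \<in> W" for x
    proof -
      have "x \<in> carrier H" using that openin_subset[OF W(1)] top by auto
      then show ?thesis using W(4)[rule_format, OF W(2) that] by simp
    qed
    then show "\<exists>X. openin TH X \<and> \<one>\<^bsub>H\<^esub> \<in> X \<and> (\<forall>x\<in>X. inv\<^bsub>H\<^esub> x \<in> X) \<and> ((0::nat) = 0 \<longrightarrow> X \<subseteq> U)"
      using W by (intro exI[of _ W]) auto
  next
    fix X and n :: nat
    assume "openin TH X \<and> \<one>\<^bsub>H\<^esub> \<in> X \<and> (\<forall>x\<in>X. inv\<^bsub>H\<^esub> x \<in> X) \<and> (n = 0 \<longrightarrow> X \<subseteq> U)"
    then obtain W where "openin TH W" "\<one>\<^bsub>H\<^esub> \<in> W" "\<forall>x\<in>W. inv\<^bsub>H\<^esub> x \<in> W" "\<forall>x\<in>W. \<forall>y\<in>W. x \<otimes>\<^bsub>H\<^esub> y \<in> X"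
      using symmetric_square_root_neighbourhood[OF H, of X] by metis
    then show "\<exists>Y. (openin TH Y \<and> \<one>\<^bsub>H\<^esub> \<in> Y \<and> (\<forall>x\<in>Y. inv\<^bsub>H\<^esub> x \<in> Y) \<and> (Suc n = 0 \<longrightarrow> Y \<subseteq> U)) \<and>
        (\<forall>x\<in>Y. \<forall>y\<in>Y. x \<otimes>\<^bsub>H\<^esub> y \<in> X)"
      by (intro exI[of _ W]) simp
  qed
  then obtain V where V: "\<And>n. openin TH (V n)" "\<And>n. \<one>\<^bsub>H\<^esub> \<in> V n" "\<And>n x. x \<in> V n \<Longrightarrow> inv\<^bsub>H\<^esub> x \<in> V n"
    "V 0 \<subseteq> U" "\<And>n x y. x \<in> V (Suc n) \<Longrightarrow> y \<in> V (Suc n) \<Longrightarrow> x \<otimes>\<^bsub>H\<^esub> y \<in> V n"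
    by metis
  define P where "P n = {g \<in> carrier G. \<phi> g \<in> V n}" for n
  have Pc: "g \<in> carrier G" if "g \<in> P n" for g n using that by (simp add: P_def)
  have Pinv: "inv g \<in> P n" if "g \<in> P n" for g n using that V(3) by (simp add: P_def)
  have Pmult: "g \<otimes> k \<in> P n" if "g \<in> P (Suc n)" "k \<in> P (Suc n)" for g k n
    using that V(5) by (simp add: P_def)
  have Pone: "\<one> \<in> P n" for n using V(2) by (simp add: P_def)
  have Psub: "P (Suc n) \<subseteq> P n" for n
    using Pmult[OF _ Pone] Pc by fastforce

  have "nbhd_of TH \<one>\<^bsub>H\<^esub> (V 5)"
    unfolding nbhd_of_def using V(1,2) openin_subset by blast
  then obtain K :: "real set" and S where S: "|K| <o |UNIV :: real set|" "S \<subseteq> carrier H" "|S| <o |K|"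
    "carrier H \<subseteq> (\<Union>s\<in>S. s <#\<^bsub>H\<^esub> V 5)"
    using souslin unfolding uniform_souslin_lt_continuum_def covered_by_fewer_translates_def by blast
  have SK: "|S| <o |UNIV :: real set|" using S(1,3) ordLess_transitive by blast
  have pigeon: "\<exists>\<alpha> \<beta>. \<alpha> \<noteq> \<beta> \<and> inv (h \<alpha>) \<otimes> h \<beta> \<in> P 4" if h: "\<And>\<alpha>. h \<alpha> \<in> carrier G"
    for h :: "(nat \<Rightarrow> bool) \<Rightarrow> 'a"
  proof -
    have "V 5 \<subseteq> carrier H" using openin_subset[OF V(1)] top by simp
    moreover have "\<phi> (h \<alpha>) \<in> carrier H" for \<alpha> using h by simp
    ultimately obtain \<alpha> \<beta> v w where ab: "\<alpha> \<noteq> \<beta>" "v \<in> V 5" "w \<in> V 5"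
      "inv\<^bsub>H\<^esub> (\<phi> (h \<alpha>)) \<otimes>\<^bsub>H\<^esub> \<phi> (h \<beta>) = inv\<^bsub>H\<^esub> v \<otimes>\<^bsub>H\<^esub> w"
      using small_translate_cover_pigeonhole[OF \<phi>.H.group_axioms _ _ S(2) SK S(4), of "\<lambda>\<alpha>. \<phi> (h \<alpha>)"]
      by metis
    have "inv\<^bsub>H\<^esub> v \<otimes>\<^bsub>H\<^esub> w \<in> V 4" using V(5)[of _ 4] V(3) ab(2,3) by simp
    then have "inv (h \<alpha>) \<otimes> h \<beta> \<in> P 4" using ab(4) h by (simp add: P_def)
    then show ?thesis using ab(1) by blast
  qed

  have A: "\<not> meagre_in T (P 4)"
  proof
    assume "meagre_in T (P 4)"
    then show False
    proof (rule Mycielski_quotients)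
      fix h :: "(nat \<Rightarrow> bool) \<Rightarrow> 'a"
      assume "\<And>\<alpha>. h \<alpha> \<in> carrier G" "\<And>\<alpha> \<beta>. \<alpha> \<noteq> \<beta> \<Longrightarrow> inv (h \<alpha>) \<otimes> h \<beta> \<notin> P 4"
      then show False using pigeon[of h] by blast
    qed
  qed

  have "openin d.mtopology {g \<in> carrier G. \<phi> g \<in> V 2}"
    using openin_continuous_map_preimage[OF cont V(1)] by simp
  then obtain \<epsilon> where \<epsilon>: "\<epsilon> > 0" "d.mball \<one> \<epsilon> \<subseteq> P 2"
    using Pone[of 2] unfolding d.openin_mtopology P_def by auto

  define B where "B = carrier G - P 1"
  have "\<not> everywhere_nonmeagre T B (carrier G)"
  proof
    assume B: "everywhere_nonmeagre T B (carrier G)"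
    have P4: "P 4 \<subseteq> carrier G" by (auto simp: P_def)
    show False
    proof (rule conjugating_Cantor_scheme[OF ample A P4 B \<epsilon>(1)])
      fix h :: "(nat \<Rightarrow> bool) \<Rightarrow> 'a"
      assume h: "\<And>\<alpha>. h \<alpha> \<in> carrier G" and
        meet: "\<And>\<alpha> \<beta> n. (\<And>i. i < n \<Longrightarrow> \<alpha> i = \<beta> i) \<Longrightarrow> \<not> \<alpha> n \<Longrightarrow> \<beta> n \<Longrightarrow>
          \<exists>x\<in>P 4. \<exists>y\<in>B \<inter> carrier G. d (cj (h \<alpha>) x) (cj (h \<beta>) y) < \<epsilon>"
      have "\<exists>\<alpha> \<beta>. \<alpha> \<noteq> \<beta> \<and> inv (h \<alpha>) \<otimes> h \<beta> \<in> P 4" by (rule pigeon) (rule h)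
      then obtain \<gamma> \<delta> where gd: "\<gamma> \<noteq> \<delta>" "inv (h \<gamma>) \<otimes> h \<delta> \<in> P 4" by auto
      have gd': "inv (h \<delta>) \<otimes> h \<gamma> \<in> P 4"
        using Pinv[OF gd(2)] h[of \<gamma>] h[of \<delta>] by (simp add: inv_mult_group)
      define n where "n = (LEAST i. \<gamma> i \<noteq> \<delta> i)"
      have n: "\<gamma> n \<noteq> \<delta> n" 
        using LeastI_ex[of "\<lambda>i. \<gamma> i \<noteq> \<delta> i"] gd(1) by (auto simp: n_def fun_eq_iff)
      have below: "\<gamma> i = \<delta> i" if "i < n" for i 
        using not_less_Least[of i "\<lambda>i. \<gamma> i \<noteq> \<delta> i"] that by (simp add: n_def)
      \<comment> \<open>The scheme fixes which index has \<open>False\<close> at the first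
        difference, while the collision comes unordered; symmetry of \<open>P 4\<close> supplies the
        quotient in the required order.\<close>
      obtain \<alpha> \<beta> where ab: "\<And>i. i < n \<Longrightarrow> \<alpha> i = \<beta> i" "\<not> \<alpha> n" "\<beta> n" "inv (h \<beta>) \<otimes> h \<alpha> \<in> P 4"
      proof (cases "\<delta> n")
        case True
        then show thesis using that[of \<gamma> \<delta>] below n gd' by blast
      next
        case False
        then show thesis using that[of \<delta> \<gamma>] below n gd(2) by blast
      qed
      then obtain x y where xy: "x \<in> P 4" "y \<in> B" "y \<in> carrier G" "d (cj (h \<alpha>) x) (cj (h \<beta>) y) < \<epsilon>"
        using meet by blast
      define k where "k = inv (h \<beta>) \<otimes> h \<alpha>"
      have k: "k \<in> P 4" using ab(4) by (simp add: k_def)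
      have kc: "k \<in> carrier G" "x \<in> carrier G" using Pc k xy(1) by blast+
      have "d (cj k x) y < \<epsilon>"
        using xy d_cj_inv_left[OF h h kc(2) xy(3)] by (simp add: k_def)
      \<comment> \<open>Left invariance moves the small distance to the identity, where the ball of
        radius \<open>\<epsilon>\<close> lies in \<open>P 2\<close>.\<close>
      moreover have "d (cj k x) y = d \<one> (inv (cj k x) \<otimes> y)"
        using d_left[of "inv (cj k x)" "cj k x" y] kc xy(3) by simp
      ultimately have u: "inv (cj k x) \<otimes> y \<in> P 2" using \<epsilon>(2) kc xy(3) by auto
      have "k \<otimes> x \<in> P 3" using Pmult[of k 3 x] k xy(1) by simp
      moreover have "inv k \<in> P 3" using Psub[of 3] Pinv[OF k] by auto
      ultimately have "cj k x \<in> P 2" using Pmult[of _ 2] by (simp add: cj_def)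
      from Pmult[of _ 1, OF _ ] this u have "cj k x \<otimes> (inv (cj k x) \<otimes> y) \<in> P 1"
        by (simp add: numeral_2_eq_2)
      then have "y \<in> P 1" using kc xy(3) by (simp add: m_assoc[symmetric])
      then show False using xy(2) by (simp add: B_def)
    qed
  qed
  then obtain W where W: "openin T W" "W \<noteq> {}" "meagre_in T (B \<inter> W)"
    unfolding everywhere_nonmeagre_def by blast
  have Wc: "W \<subseteq> carrier G" using openin_subset[OF W(1)] by simp
  obtain w where w: "w \<in> W" using W(2) by blast
  have wc: "w \<in> carrier G" using w Wc by blast
  \<comment> \<open>Pettis: for \<open>g\<close> in this neighbourhood of the identity,
    \<open>W\<close> and its translate by \<open>inv g\<close> share \<open>w\<close>, so their open
    intersection contains some \<open>b\<close> with neither \<open>b\<close> nor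
    \<open>g \<otimes> b\<close> in \<open>B\<close>. Then \<open>g\<close> is the quotient of two
    elements of \<open>P 1\<close>.\<close>
  define N where "N = {g \<in> topspace T. g \<otimes> w \<in> W}"
  have "continuous_map T T (\<lambda>g. g \<otimes> w)"
    by (rule continuous_map_mult) (use wc in auto)
  from openin_continuous_map_preimage[OF this W(1)] have oN: "openin T N" by (simp add: N_def)
  have "g \<in> P 0" if g: "g \<in> N" for g
  proof -
    have gc: "g \<in> carrier G" using g by (simp add: N_def)
    have "continuous_map T T (\<lambda>b. g \<otimes> b)"
      by (rule continuous_map_mult) (use gc in auto)
    from openin_Int[OF W(1) openin_continuous_map_preimage[OF this W(1)]]
    have o: "openin T (W \<inter> {b \<in> topspace T. g \<otimes> b \<in> W})" .
    have ne: "W \<inter> {b \<in> topspace T. g \<otimes> b \<in> W} \<noteq> {}"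
      using w wc g by (auto simp: N_def)
    \<comment> \<open>The double inverse only brings the condition
      \<open>g \<otimes> b \<in> B \<inter> W\<close> into the form of
      \<open>meagre_left_quotient\<close>.\<close>
    have bad: "meagre_in T ((B \<inter> W) \<union> {b \<in> carrier G. inv (inv g) \<otimes> b \<in> B \<inter> W})"
      by (intro meagre_in_Un W(3) meagre_left_quotient inv_closed gc)
    have "\<not> W \<inter> {b \<in> topspace T. g \<otimes> b \<in> W} \<subseteq>
        (B \<inter> W) \<union> {b \<in> carrier G. inv (inv g) \<otimes> b \<in> B \<inter> W}"
      using Baire_not_meagre[OF completely_metrizable_T o ne] meagre_in_subset[OF bad] by blast
    then obtain b where "b \<in> W \<inter> {b \<in> topspace T. g \<otimes> b \<in> W}"
      "b \<notin> (B \<inter> W) \<union> {b \<in> carrier G. inv (inv g) \<otimes> b \<in> B \<inter> W}" by blast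
    then have b: "g \<otimes> b \<in> carrier G" "b \<in> carrier G" "b \<notin> B" "g \<otimes> b \<notin> B"
      using gc by auto
    have "(g \<otimes> b) \<otimes> inv b \<in> P 0"
      using Pmult[of "g \<otimes> b" 0 "inv b"] Pinv[of b 1] b by (simp add: B_def)
    then show ?thesis using b(2) gc by (simp add: m_assoc)
  qed
  then have "\<phi> ` N \<subseteq> U" using V(4) by (auto simp: P_def)
  moreover have "\<one> \<in> N" using w wc by (simp add: N_def)
  ultimately show ?thesis using oN by blast
qed

end

theorem theorem4p7:
  fixes G :: "('a, 'b) monoid_scheme" and T :: "'a topology" and d :: "'a \<Rightarrow> 'a \<Rightarrow> real"
    and H :: "('c, 'e) monoid_scheme" and TH :: "'c topology" and \<phi> :: "'a \<Rightarrow> 'c"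
  assumes "Polish_topometric_group G T d"
    and "ample_generics G T d"
    and "topological_group H TH"
    and "uniform_souslin_lt_continuum H TH"
    and "\<phi> \<in> hom G H"
    and "continuous_map (Metric_space.mtopology (carrier G) d) TH \<phi>"
  shows "continuous_map T TH \<phi>"
proof -
  have G: "topological_group G T" "Polish_space T" "topometric_space T d" "bi_invariant G d"
    using assms(1) by (simp_all add: Polish_topometric_group_def Polish_group_def)
  interpret G: group G using G(1) by (simp add: topological_group_def)
  have top: "topspace T = carrier G" using G(1) by (simp add: topological_group_def)
  obtain M m where M: "Metric_space M m" "Metric_space.mcomplete M m" "T = Metric_space.mtopology M m"
    using G(2) by (auto simp: Polish_space_def completely_metrizable_space_def)
  have "M = carrier G" using top M Metric_space.topspace_mtopology by metis
  note M = M[unfolded this]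
  have sc: "second_countable T"
    using Metric_space.separable_imp_second_countable[OF M(1)] G(2) M(3) by (simp add: Polish_space_def)
  interpret G: metrized_topometric_group G T m d
    by (intro metrized_topometric_group.intro completely_metrized_group.intro
        completely_metrized_group_axioms.intro metrized_topometric_group_axioms.intro
        G.group_axioms M sc G(3,4))
      (use G(1) in \<open>simp_all add: topological_group_def\<close>)
  interpret \<phi>: group_hom G H \<phi>
    using assms(3,5) by (simp add: topological_group_def group_hom_def group_hom_axioms_def G.group_axioms)
  have topH: "topspace TH = carrier H"
    and mult: "continuous_map (prod_topology TH TH) TH (\<lambda>(x, y). x \<otimes>\<^bsub>H\<^esub> y)"
    using assms(3) by (simp_all add: topological_group_def)
  show ?thesis
    unfolding continuous_map
  proof (intro conjI allI impI)
    fix U assume U: "openin TH U"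
    show "openin T {x \<in> topspace T. \<phi> x \<in> U}"
    proof (subst openin_subopen, intro ballI)
      fix x assume "x \<in> {x \<in> topspace T. \<phi> x \<in> U}"
      then have x: "x \<in> carrier G" "\<phi> x \<in> U" by (simp_all add: top)
      let ?U = "{h \<in> topspace TH. \<phi> x \<otimes>\<^bsub>H\<^esub> h \<in> U}"
      have "continuous_map TH (prod_topology TH TH) (\<lambda>h. (\<phi> x, h))"
        using x(1) topH by (simp add: continuous_map_pairedI)
      from continuous_map_compose[OF this mult]
      have "continuous_map TH TH (\<lambda>h. \<phi> x \<otimes>\<^bsub>H\<^esub> h)" by (simp add: o_def)
      from openin_continuous_map_preimage[OF this U] have oU: "openin TH ?U" .
      have oneU: "\<one>\<^bsub>H\<^esub> \<in> ?U" using x by (simp add: topH)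
      obtain N where N: "openin T N" "\<one>\<^bsub>G\<^esub> \<in> N" "\<phi> ` N \<subseteq> ?U"
        using G.homomorphism_continuous_at_one[OF assms(2-6) oU oneU] by (elim exE conjE)
      let ?O = "{y \<in> topspace T. inv\<^bsub>G\<^esub> x \<otimes>\<^bsub>G\<^esub> y \<in> N}"
      have "continuous_map T T (\<lambda>y. inv\<^bsub>G\<^esub> x \<otimes>\<^bsub>G\<^esub> y)"
        by (rule G.continuous_map_mult) (use x(1) top in auto)
      from openin_continuous_map_preimage[OF this N(1)] have "openin T ?O" .
      moreover have "x \<in> ?O" using x(1) N(2) by (simp add: top)
      moreover have "?O \<subseteq> {x \<in> topspace T. \<phi> x \<in> U}"
      proof
        fix y assume y: "y \<in> ?O"
        then have yc: "y \<in> carrier G" by (simp add: top)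
        have "\<phi> (inv\<^bsub>G\<^esub> x \<otimes>\<^bsub>G\<^esub> y) \<in> ?U" using y N(3) by blast
        then have "\<phi> (x \<otimes>\<^bsub>G\<^esub> (inv\<^bsub>G\<^esub> x \<otimes>\<^bsub>G\<^esub> y)) \<in> U" using x(1) yc by (subst \<phi>.hom_mult) auto
        then show "y \<in> {x \<in> topspace T. \<phi> x \<in> U}"
          using x(1) yc by (simp add: top G.m_assoc[symmetric])
      qed
      ultimately show "\<exists>O'. openin T O' \<and> x \<in> O' \<and> O' \<subseteq> {x \<in> topspace T. \<phi> x \<in> U}"
        by (intro exI[of _ ?O] conjI)
    qed
  qed (auto simp: top topH)
qed

end
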